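(* Let $F$ be a finite field of characteristic $p$ with $|F|=q=p^k$ and let $G=C_6 \rtimes C_4$. If $p>3$, then $$U(FG) \cong \begin{cases} C_{p^k-1}^8 \times GL(2,F)^4, & \text{if } q \equiv 1 \text{ or } 5 \bmod 12;\\ C_{p^k-1}^4 \times C_{p^{2k}-1}^2 \times GL(2, F)^4, & \text{if } q \equiv -1 \text{ or } -5 \bmod 12.\end{cases}$$
   Context: $FG$ denotes the group algebra of a finite group $G$ over $F$, and $U(FG)$ its group of units. $C_n$ is the cyclic group of order $n$, and $H^m$ denotes the direct product of $m$ copies of a group $H$. The group $C_6 \rtimes C_4$ is the group of order $24$ with presentation $\langle x, y \mid x^{4}=y^6=1,\ yxy=x\rangle$. *)

theory Defs
  imports "HOL-Algebra.Algebra" "HOL-Library.Cardinality" "HOL-Number_Theory.Cong" "Jordan_Normal_Form.Matrix"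
begin

section \<open>Group presentations\<close>

text \<open>
  A letter \<open>(g, False)\<close> stands for the generator \<open>g\<close>, and \<open>(g, True)\<close> for its formal inverse.
\<close>

type_synonym 'g group_word = "('g \<times> bool) list"

definition word_val :: "('a, 'm) monoid_scheme \<Rightarrow> ('g \<Rightarrow> 'a) \<Rightarrow> 'g group_word \<Rightarrow> 'a" where
  "word_val G f w =
     foldr (\<lambda>(g, b) z. (if b then inv\<^bsub>G\<^esub> (f g) else f g) \<otimes>\<^bsub>G\<^esub> z) w \<one>\<^bsub>G\<^esub>"

text \<open>
  Two words are related iff they represent the same element of the quotient of the free group by
  the normal closure of the relators \<open>R\<close>.
\<close>

inductive word_cong :: "'g group_word set \<Rightarrow> 'g group_word \<Rightarrow> 'g group_word \<Rightarrow> bool"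
  for R :: "'g group_word set" where
  refl: "word_cong R w w"
| sym: "word_cong R v w \<Longrightarrow> word_cong R w v"
| trans: "word_cong R u v \<Longrightarrow> word_cong R v w \<Longrightarrow> word_cong R u w"
| cancel: "word_cong R (u @ [(g, b), (g, \<not> b)] @ v) (u @ v)"
| relator: "r \<in> R \<Longrightarrow> word_cong R (u @ r @ v) (u @ v)"

text \<open>
  \<open>G\<close> is presented by the generators \<open>f g\<close>, one for each element \<open>g\<close> of the type \<open>'g\<close>, and the
  relators \<open>R\<close>: the homomorphism from the free group to \<open>G\<close> given by \<open>f\<close> is surjective and its
  kernel is the normal closure of \<open>R\<close>.
\<close>

definition has_presentation ::
    "('a, 'm) monoid_scheme \<Rightarrow> ('g \<Rightarrow> 'a) \<Rightarrow> 'g group_word set \<Rightarrow> bool" where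
  "has_presentation G f R \<longleftrightarrow>
     group G \<and> range f \<subseteq> carrier G \<and> generate G (range f) = carrier G \<and>
     (\<forall>w. word_val G f w = \<one>\<^bsub>G\<^esub> \<longleftrightarrow> word_cong R w [])"

section \<open>The group \<open>C\<^sub>6 \<rtimes> C\<^sub>4\<close>\<close>

datatype gen_xy = Gen_x | Gen_y

text \<open>The relation \<open>y x y = x\<close> becomes the relator \<open>y x y x\<^sup>-\<^sup>1\<close>.\<close>

definition C6_C4_relators :: "gen_xy group_word set" where
  "C6_C4_relators =
     {replicate 4 (Gen_x, False),
      replicate 6 (Gen_y, False),
      [(Gen_y, False), (Gen_x, False), (Gen_y, False), (Gen_x, True)]}"

definition is_C6_rtimes_C4 :: "('a, 'm) monoid_scheme \<Rightarrow> bool" where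
  "is_C6_rtimes_C4 G \<longleftrightarrow>
     order G = 24 \<and> (\<exists>f :: gen_xy \<Rightarrow> 'a. has_presentation G f C6_C4_relators)"

section \<open>Group algebras\<close>

text \<open>
  For finite \<open>G\<close>, the formal sum \<open>\<Sum>g. a g \<cdot> g\<close> is represented by its coefficient function,
  which is required to vanish outside the carrier of \<open>G\<close>.
\<close>

definition group_algebra :: "('g, 'm) monoid_scheme \<Rightarrow> ('g \<Rightarrow> 'f :: field) ring" where
  "group_algebra G =
     \<lparr>carrier = {a. \<forall>g. g \<notin> carrier G \<longrightarrow> a g = 0},
      monoid.mult = (\<lambda>a b g. if g \<in> carrier G
                       then \<Sum>h\<in>carrier G. a h * b (inv\<^bsub>G\<^esub> h \<otimes>\<^bsub>G\<^esub> g) else 0),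
      monoid.one = (\<lambda>g. if g = \<one>\<^bsub>G\<^esub> then 1 else 0),
      ring.zero = (\<lambda>g. 0),
      ring.add = (\<lambda>a b g. a g + b g)\<rparr>"

section \<open>The groups in the decomposition\<close>

abbreviation cyclic :: "nat \<Rightarrow> int monoid" where
  "cyclic n \<equiv> integer_mod_group n"

definition group_power :: "('a, 'm) monoid_scheme \<Rightarrow> nat \<Rightarrow> (nat \<Rightarrow> 'a) monoid" where
  "group_power H m = product_group {..<m} (\<lambda>_. H)"

definition GL :: "nat \<Rightarrow> 'f :: field itself \<Rightarrow> 'f mat monoid" where
  "GL n F = units_of (ring_mat F n ())"

section \<open>Well-definedness\<close>

text \<open>
  The group algebra of a finite group is a ring, and \<^const>\<open>is_C6_rtimes_C4\<close> has a model.
\<close>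

lemma ring_group_algebra:
  fixes G (structure)
  assumes "group G" "finite (carrier G)"
  shows "ring (group_algebra G :: ('g \<Rightarrow> 'f :: field) ring)"
proof -
  interpret group G by fact
  let ?A = "group_algebra G :: ('g \<Rightarrow> 'f) ring"
  have delta: "(\<Sum>h\<in>carrier G. (if h = k then c h else 0)) = c k"
    if "k \<in> carrier G" for k and c :: "'g \<Rightarrow> 'f"
    using that assms(2) by simp
  show ?thesis
  proof (rule ringI)
    show "abelian_group ?A"
    proof (rule abelian_groupI)
      fix a assume "a \<in> carrier ?A"
      then have "(\<lambda>g. - a g) \<in> carrier ?A" "(\<lambda>g. - a g) \<oplus>\<^bsub>?A\<^esub> a = \<zero>\<^bsub>?A\<^esub>"
        by (auto simp: group_algebra_def)
      then show "\<exists>b\<in>carrier ?A. b \<oplus>\<^bsub>?A\<^esub> a = \<zero>\<^bsub>?A\<^esub>" by blast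
    qed (auto simp: group_algebra_def algebra_simps)
    show "monoid ?A"
    proof (rule monoidI)
      fix a b c assume abc: "a \<in> carrier ?A" "b \<in> carrier ?A" "c \<in> carrier ?A"
      show "a \<otimes>\<^bsub>?A\<^esub> b \<otimes>\<^bsub>?A\<^esub> c = a \<otimes>\<^bsub>?A\<^esub> (b \<otimes>\<^bsub>?A\<^esub> c)"
      proof
        fix g
        show "(a \<otimes>\<^bsub>?A\<^esub> b \<otimes>\<^bsub>?A\<^esub> c) g = (a \<otimes>\<^bsub>?A\<^esub> (b \<otimes>\<^bsub>?A\<^esub> c)) g"
        proof (cases "g \<in> carrier G")
          case True
          have "(a \<otimes>\<^bsub>?A\<^esub> b \<otimes>\<^bsub>?A\<^esub> c) g =
              (\<Sum>h\<in>carrier G. \<Sum>k\<in>carrier G. a k * b (inv k \<otimes> h) * c (inv h \<otimes> g))"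
            using True by (simp add: group_algebra_def sum_distrib_right)
          also have "\<dots> = (\<Sum>k\<in>carrier G. \<Sum>h\<in>carrier G. a k * b (inv k \<otimes> h) * c (inv h \<otimes> g))"
            by (rule sum.swap)
          also have "\<dots> = (\<Sum>k\<in>carrier G. \<Sum>l\<in>carrier G. a k * b l * c (inv l \<otimes> (inv k \<otimes> g)))"
          proof (rule sum.cong[OF HOL.refl])
            fix k assume k: "k \<in> carrier G"
            have eq: "inv h \<otimes> k \<otimes> inv k \<otimes> g = inv h \<otimes> g" if "h \<in> carrier G" for h
              using that k True by (simp add: m_assoc)
            show "(\<Sum>h\<in>carrier G. a k * b (inv k \<otimes> h) * c (inv h \<otimes> g)) =
                (\<Sum>l\<in>carrier G. a k * b l * c (inv l \<otimes> (inv k \<otimes> g)))"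
              by (rule sum.reindex_bij_witness[of _ "\<lambda>l. k \<otimes> l" "\<lambda>h. inv k \<otimes> h"])
                 (use k True in \<open>auto simp: m_assoc[symmetric] inv_mult_group eq\<close>)
          qed
          also have "\<dots> = (a \<otimes>\<^bsub>?A\<^esub> (b \<otimes>\<^bsub>?A\<^esub> c)) g"
            using True by (simp add: group_algebra_def sum_distrib_left mult.assoc)
          finally show ?thesis .
        qed (simp add: group_algebra_def)
      qed
    next
      fix a assume a: "a \<in> carrier ?A"
      have "(\<one>\<^bsub>?A\<^esub> \<otimes>\<^bsub>?A\<^esub> a) g = a g" for g
        using a by (auto simp: group_algebra_def if_distrib[of "\<lambda>x. x * _"] delta cong: if_cong)
      then show "\<one>\<^bsub>?A\<^esub> \<otimes>\<^bsub>?A\<^esub> a = a" by blast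
      have "(a \<otimes>\<^bsub>?A\<^esub> \<one>\<^bsub>?A\<^esub>) g = a g" for g
      proof (cases "g \<in> carrier G")
        case True
        then have eq: "inv h \<otimes> g = \<one> \<longleftrightarrow> h = g" if "h \<in> carrier G" for h
          using that by (metis inv_equality inv_inv inv_closed l_inv)
        have "(a \<otimes>\<^bsub>?A\<^esub> \<one>\<^bsub>?A\<^esub>) g = (\<Sum>h\<in>carrier G. if h = g then a h else 0)"
          using True by (auto simp: group_algebra_def eq intro!: sum.cong)
        with True show ?thesis by (simp add: delta)
      qed (use a in \<open>auto simp: group_algebra_def\<close>)
      then show "a \<otimes>\<^bsub>?A\<^esub> \<one>\<^bsub>?A\<^esub> = a" by blast
    qed (auto simp: group_algebra_def)
  qed (auto simp: group_algebra_def fun_eq_iff algebra_simps sum.distrib)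
qed

lemma word_val_Nil [simp]: "word_val G f [] = \<one>\<^bsub>G\<^esub>"
  by (simp add: word_val_def)

lemma word_val_Cons [simp]:
  "word_val G f ((g, b) # w) = (if b then inv\<^bsub>G\<^esub> (f g) else f g) \<otimes>\<^bsub>G\<^esub> word_val G f w"
  by (simp add: word_val_def)

lemma word_val_closed:
  assumes "group G" "range f \<subseteq> carrier G"
  shows "word_val G f w \<in> carrier G"
proof -
  interpret group G by fact
  have "f g \<in> carrier G" for g using assms by auto
  then show ?thesis by (induction w) auto
qed

lemma word_val_append:
  assumes "group G" "range f \<subseteq> carrier G"
  shows "word_val G f (u @ v) = word_val G f u \<otimes>\<^bsub>G\<^esub> word_val G f v"
proof -
  interpret group G by fact
  have "f g \<in> carrier G" for g using assms by auto
  then show ?thesis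
    by (induction u) (auto simp: m_assoc word_val_closed[OF assms])
qed

lemma word_val_cong:
  assumes "group G" "range f \<subseteq> carrier G" "\<And>r. r \<in> R \<Longrightarrow> word_val G f r = \<one>\<^bsub>G\<^esub>"
  assumes "word_cong R u v"
  shows "word_val G f u = word_val G f v"
proof -
  interpret group G by fact
  have f: "f g \<in> carrier G" for g using assms by auto
  note [simp] = word_val_append[OF assms(1,2)] word_val_closed[OF assms(1,2)]
  show ?thesis using assms(4)
  proof induction
    case (cancel u g b v)
    then show ?case by (cases b) (simp_all add: f m_assoc[symmetric])
  qed (auto simp: assms(3))
qed

lemma word_cong_append:
  assumes "word_cong R u v"
  shows "word_cong R (s @ u @ t) (s @ v @ t)"
  using assms
proof induction
  case (cancel u g b v)
  then show ?case using word_cong.cancel[of R "s @ u" g b "v @ t"] by simp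
next
  case (relator r u v)
  then show ?case using word_cong.relator[of r R "s @ u" "v @ t"] by simp
qed (blast intro: word_cong.intros)+

text \<open>An explicit model of \<open>C\<^sub>6 \<rtimes> C\<^sub>4\<close>: the pair \<open>(i, j)\<close> stands for \<open>x\<^sup>i y\<^sup>j\<close>.\<close>

definition C6_C4_model :: "(int \<times> int) monoid" where
  "C6_C4_model =
     \<lparr>carrier = {0..<4} \<times> {0..<6},
      monoid.mult = (\<lambda>(i, j) (k, l). ((i + k) mod 4, ((if even k then j else - j) + l) mod 6)),
      one = (0, 0)\<rparr>"

lemma even_mod_4: "even (x mod 4) \<longleftrightarrow> even (x :: int)" by presburger

lemma group_C6_C4_model: "group C6_C4_model"
proof (rule groupI)
  fix x y z assume "x \<in> carrier C6_C4_model" "y \<in> carrier C6_C4_model" "z \<in> carrier C6_C4_model"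
  obtain a b c d e f where xyz: "x = (a, b)" "y = (c, d)" "z = (e, f)" by (metis surj_pair)
  have "(- (t mod 6) + f) mod 6 = (- t + f) mod 6" for t :: int by (simp add: mod_simps)
  then show "x \<otimes>\<^bsub>C6_C4_model\<^esub> y \<otimes>\<^bsub>C6_C4_model\<^esub> z = x \<otimes>\<^bsub>C6_C4_model\<^esub> (y \<otimes>\<^bsub>C6_C4_model\<^esub> z)"
    by (auto simp: C6_C4_model_def xyz even_mod_4 mod_simps algebra_simps)
next
  fix x assume x: "x \<in> carrier C6_C4_model"
  then obtain a b where ab: "x = (a, b)" "0 \<le> a" "a < 4" "0 \<le> b" "b < 6"
    by (auto simp: C6_C4_model_def)
  have "((- a) mod 4, (if even a then - b else b) mod 6) \<in> carrier C6_C4_model"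
    by (simp add: C6_C4_model_def)
  moreover have "((- a) mod 4, (if even a then - b else b) mod 6) \<otimes>\<^bsub>C6_C4_model\<^esub> x = \<one>\<^bsub>C6_C4_model\<^esub>"
    by (auto simp: C6_C4_model_def ab mod_simps)
  ultimately show "\<exists>y\<in>carrier C6_C4_model. y \<otimes>\<^bsub>C6_C4_model\<^esub> x = \<one>\<^bsub>C6_C4_model\<^esub>"
    by blast
qed (auto simp: C6_C4_model_def)

abbreviation (input) lx :: "gen_xy \<times> bool" where "lx \<equiv> (Gen_x, False)"
abbreviation (input) ly :: "gen_xy \<times> bool" where "ly \<equiv> (Gen_y, False)"
abbreviation (input) lx' :: "gen_xy \<times> bool" where "lx' \<equiv> (Gen_x, True)"
abbreviation (input) ly' :: "gen_xy \<times> bool" where "ly' \<equiv> (Gen_y, True)"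

abbreviation eqv :: "gen_xy group_word \<Rightarrow> gen_xy group_word \<Rightarrow> bool" (infix "\<bowtie>" 50)
  where "u \<bowtie> v \<equiv> word_cong C6_C4_relators u v"

lemma eqv_app: "u \<bowtie> v \<Longrightarrow> s @ u @ t \<bowtie> s @ v @ t" by (rule word_cong_append)
lemma eqv_left: "u \<bowtie> v \<Longrightarrow> s @ u \<bowtie> s @ v" using eqv_app[of u v s "[]"] by simp
lemma eqv_right: "u \<bowtie> v \<Longrightarrow> u @ t \<bowtie> v @ t" using eqv_app[of u v "[]" t] by simp
lemmas [trans] = word_cong.trans

lemma x4: "replicate 4 lx @ w \<bowtie> w" 
  using word_cong.relator[of "replicate 4 lx" C6_C4_relators "[]" w] by (simp add: C6_C4_relators_def)
lemma y6: "replicate 6 ly @ w \<bowtie> w" 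
  using word_cong.relator[of "replicate 6 ly" C6_C4_relators "[]" w] by (simp add: C6_C4_relators_def)

lemma x': "[lx'] \<bowtie> replicate 3 lx"
proof -
  have "[lx'] \<bowtie> replicate 4 lx @ [lx']" by (rule word_cong.sym[OF x4])
  also have "replicate 4 lx @ [lx'] = replicate 3 lx @ [lx, lx'] @ []" by (simp add: eval_nat_numeral)
  also have "\<dots> \<bowtie> replicate 3 lx"
    using word_cong.cancel[of C6_C4_relators "replicate 3 lx" Gen_x False "[]"] by simp
  finally show ?thesis .
qed

lemma y': "[ly'] \<bowtie> replicate 5 ly"
proof -
  have "[ly'] \<bowtie> replicate 6 ly @ [ly']" by (rule word_cong.sym[OF y6])
  also have "replicate 6 ly @ [ly'] = replicate 5 ly @ [ly, ly'] @ []" by (simp add: eval_nat_numeral)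
  also have "\<dots> \<bowtie> replicate 5 ly"
    using word_cong.cancel[of C6_C4_relators "replicate 5 ly" Gen_y False "[]"] by simp
  finally show ?thesis .
qed

lemma yx: "[ly, lx] \<bowtie> lx # replicate 5 ly"
proof -
  have "[ly, lx] \<bowtie> [ly, lx] @ [ly, ly'] @ []"
    by (rule word_cong.sym) (use word_cong.cancel[of _ "[ly,lx]" Gen_y False "[]"] in simp)
  also have "\<dots> \<bowtie> [ly, lx, ly] @ [lx', lx] @ [ly']"
    by (rule word_cong.sym) (use word_cong.cancel[of _ "[ly,lx,ly]" Gen_x True "[ly']"] in simp)
  also have "[ly, lx, ly] @ [lx', lx] @ [ly'] = [] @ [ly, lx, ly, lx'] @ [lx, ly']" by simp
  also have "\<dots> \<bowtie> [lx] @ [ly']"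
    using word_cong.relator[of "[ly, lx, ly, lx']" _ "[]" "[lx, ly']"] by (simp add: C6_C4_relators_def)
  also have "\<dots> \<bowtie> [lx] @ replicate 5 ly" by (rule eqv_left[OF y'])
  finally show ?thesis by simp
qed

lemma ynx: "replicate n ly @ [lx] \<bowtie> lx # replicate (5 * n) ly"
proof (induction n)
  case 0 then show ?case by (simp add: word_cong.refl)
next
  case (Suc n)
  have "replicate (Suc n) ly @ [lx] \<bowtie> [ly] @ (lx # replicate (5 * n) ly)"
    using eqv_left[OF Suc, of "[ly]"] by simp
  also have "\<dots> = [ly, lx] @ replicate (5 * n) ly" by simp
  also have "\<dots> \<bowtie> (lx # replicate 5 ly) @ replicate (5 * n) ly" by (rule eqv_right[OF yx])
  also have "\<dots> = lx # replicate (5 * Suc n) ly"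
    by (simp only: append_Cons replicate_add[symmetric]) (simp add: algebra_simps)
  finally show ?case .
qed

definition nf :: "nat \<Rightarrow> nat \<Rightarrow> gen_xy group_word" where
  "nf a b = replicate a lx @ replicate b ly"

lemma y_nf: "replicate n ly @ nf a b \<bowtie> nf a (n * 5 ^ a + b)"
proof (induction a arbitrary: n)
  case 0 then show ?case by (simp add: nf_def replicate_add word_cong.refl)
next
  case (Suc a)
  have "replicate n ly @ nf (Suc a) b = (replicate n ly @ [lx]) @ nf a b" by (simp add: nf_def)
  also have "\<dots> \<bowtie> (lx # replicate (5 * n) ly) @ nf a b" by (rule eqv_right[OF ynx])
  also have "\<dots> = [lx] @ (replicate (5 * n) ly @ nf a b)" by simp
  also have "\<dots> \<bowtie> [lx] @ nf a (5 * n * 5 ^ a + b)" by (rule eqv_left[OF Suc])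
  also have "\<dots> = nf (Suc a) (n * 5 ^ Suc a + b)" by (simp add: nf_def mult_ac)
  finally show ?case .
qed

lemma x_nf: "replicate n lx @ nf a b = nf (n + a) b" by (simp add: nf_def replicate_add)

lemma ex_nf: "\<exists>a b. w \<bowtie> nf a b"
proof (induction w)
  case Nil
  have "[] = nf 0 0" by (simp add: nf_def)
  then show ?case using word_cong.refl by metis
next
  case (Cons l w)
  then obtain a b where w: "w \<bowtie> nf a b" by blast
  obtain g n where l: "[l] \<bowtie> replicate n (g, False)"
  proof -
    obtain g i where "l = (g, i)" by fastforce
    then have "\<exists>n. [l] \<bowtie> replicate n (g, False)"
      using x' y' word_cong.refl[of _ "[l]"] by (cases g; cases i) (auto intro: exI[of _ "Suc 0"])
    then show thesis using that by blast
  qed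
  have "l # w \<bowtie> [l] @ nf a b" using eqv_left[OF w, of "[l]"] by simp
  also have "\<dots> \<bowtie> replicate n (g, False) @ nf a b" by (rule eqv_right[OF l])
  finally have *: "l # w \<bowtie> replicate n (g, False) @ nf a b" .
  show ?case
  proof (cases g)
    case Gen_x then show ?thesis using * x_nf by metis
  next
    case Gen_y then show ?thesis using * y_nf word_cong.trans by metis
  qed
qed

lemma x_red: "replicate (4 * n + a) lx @ w \<bowtie> replicate a lx @ w"
proof (induction n)
  case 0 then show ?case by (simp add: word_cong.refl)
next
  case (Suc n)
  have "replicate (4 * Suc n + a) lx @ w = replicate 4 lx @ (replicate (4 * n + a) lx @ w)"
    by (simp only: append_assoc[symmetric] replicate_add[symmetric]) (simp add: algebra_simps)
  also have "\<dots> \<bowtie> replicate (4 * n + a) lx @ w" by (rule x4)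
  also note Suc
  finally show ?case .
qed

lemma y_red: "replicate (6 * n + a) ly @ w \<bowtie> replicate a ly @ w"
proof (induction n)
  case 0 then show ?case by (simp add: word_cong.refl)
next
  case (Suc n)
  have "replicate (6 * Suc n + a) ly @ w = replicate 6 ly @ (replicate (6 * n + a) ly @ w)"
    by (simp only: append_assoc[symmetric] replicate_add[symmetric]) (simp add: algebra_simps)
  also have "\<dots> \<bowtie> replicate (6 * n + a) ly @ w" by (rule y6)
  also note Suc
  finally show ?case .
qed

lemma nf_mod: "nf a b \<bowtie> nf (a mod 4) (b mod 6)"
proof -
  have "nf a b \<bowtie> replicate (a mod 4) lx @ replicate b ly"
    using x_red[of "a div 4" "a mod 4" "replicate b ly"] by (simp add: nf_def)
  also have "\<dots> \<bowtie> nf (a mod 4) (b mod 6)"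
    using eqv_left[OF y_red[of "b div 6" "b mod 6" "[]"]] by (simp add: nf_def)
  finally show ?thesis .
qed

definition C6_C4_gens :: "gen_xy \<Rightarrow> int \<times> int" where
  "C6_C4_gens g = (case g of Gen_x \<Rightarrow> (1, 0) | Gen_y \<Rightarrow> (0, 1))"

lemma gens_carrier: "range C6_C4_gens \<subseteq> carrier C6_C4_model"
  by (auto simp: C6_C4_gens_def C6_C4_model_def split: gen_xy.splits)

lemma val_y: "b < 6 \<Longrightarrow> word_val C6_C4_model C6_C4_gens (replicate b ly) = (0, int b)"
  by (induction b) (auto simp: C6_C4_gens_def C6_C4_model_def)

lemma val_nf: "a < 4 \<Longrightarrow> b < 6 \<Longrightarrow> word_val C6_C4_model C6_C4_gens (nf a b) = (int a, int b)"
proof (induction a)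
  case 0 then show ?case by (simp add: nf_def val_y)
next
  case (Suc a) then show ?case by (simp add: nf_def) (auto simp: C6_C4_gens_def C6_C4_model_def)
qed

lemma inv_x: "inv\<^bsub>C6_C4_model\<^esub> (1, 0) = (3, 0)"
  by (rule group.inv_equality[OF group_C6_C4_model]) (auto simp: C6_C4_model_def)

lemma val_relators: "r \<in> C6_C4_relators \<Longrightarrow> word_val C6_C4_model C6_C4_gens r = \<one>\<^bsub>C6_C4_model\<^esub>"
  by (auto simp: C6_C4_relators_def C6_C4_gens_def inv_x eval_nat_numeral)
     (auto simp: C6_C4_model_def)

lemma word_val_generate:
  assumes "group G" "range f \<subseteq> carrier G"
  shows "word_val G f w \<in> generate G (range f)"
proof (induction w)
  case (Cons l w)
  have "f (fst l) \<in> generate G (range f)" "inv\<^bsub>G\<^esub> (f (fst l)) \<in> generate G (range f)"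
    by (blast intro: generate.incl generate.inv)+
  with Cons show ?case by (cases l) (auto intro: generate.eng)
qed (simp add: generate.one)

lemma C6_C4_model_presentation: "has_presentation C6_C4_model C6_C4_gens C6_C4_relators"
  unfolding has_presentation_def
proof (intro conjI allI)
  show "group C6_C4_model" by (rule group_C6_C4_model)
  show "range C6_C4_gens \<subseteq> carrier C6_C4_model" by (rule gens_carrier)
  show "generate C6_C4_model (range C6_C4_gens) = carrier C6_C4_model"
  proof
    show "generate C6_C4_model (range C6_C4_gens) \<subseteq> carrier C6_C4_model"
      using group.generate_incl[OF group_C6_C4_model gens_carrier] .
    show "carrier C6_C4_model \<subseteq> generate C6_C4_model (range C6_C4_gens)"
    proof
      fix z assume "z \<in> carrier C6_C4_model"
      then obtain i j where ij: "z = (i, j)" "0 \<le> i" "i < 4" "0 \<le> j" "j < 6"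
        by (auto simp: C6_C4_model_def)
      then have "z = word_val C6_C4_model C6_C4_gens (nf (nat i) (nat j))" by (subst val_nf) auto
      then show "z \<in> generate C6_C4_model (range C6_C4_gens)"
        using word_val_generate[OF group_C6_C4_model gens_carrier] by metis
    qed
  qed
next
  fix w
  have val: "word_val C6_C4_model C6_C4_gens u = word_val C6_C4_model C6_C4_gens v" if "u \<bowtie> v" for u v
    using word_val_cong[OF group_C6_C4_model gens_carrier val_relators that] by blast
  show "word_val C6_C4_model C6_C4_gens w = \<one>\<^bsub>C6_C4_model\<^esub> \<longleftrightarrow> w \<bowtie> []"
  proof
    assume "w \<bowtie> []"
    from val[OF this] show "word_val C6_C4_model C6_C4_gens w = \<one>\<^bsub>C6_C4_model\<^esub>" by simp
  next
    assume one: "word_val C6_C4_model C6_C4_gens w = \<one>\<^bsub>C6_C4_model\<^esub>"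
    obtain a b where ab: "w \<bowtie> nf a b" using ex_nf by blast
    then have w: "w \<bowtie> nf (a mod 4) (b mod 6)" using nf_mod word_cong.trans by metis
    from val[OF this] one have "(int (a mod 4), int (b mod 6)) = \<one>\<^bsub>C6_C4_model\<^esub>"
      by (simp add: val_nf)
    then have "a mod 4 = 0" "b mod 6 = 0" by (auto simp: C6_C4_model_def)
    then show "w \<bowtie> []" using w by (simp add: nf_def)
  qed
qed

lemma is_C6_rtimes_C4_model: "is_C6_rtimes_C4 C6_C4_model"
  unfolding is_C6_rtimes_C4_def
  using C6_C4_model_presentation by (auto simp: order_def C6_C4_model_def card_cartesian_product)

no_notation eqv (infix "\<bowtie>" 50)

end

theory Submission
  imports Defs "HOL-Algebra.Algebraic_Closure_Type"
begin

text \<open>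
  The elements \<open>x\<^sup>2\<close> and \<open>y\<^sup>3\<close> are central involutions, so the group algebra splits into four blocks
  on which \<open>x\<^sup>2 = s\<close> and \<open>y\<^sup>3 = t\<close> with signs \<open>s\<close>, \<open>t\<close>. Each block of dimension 6 is the product of
  \<open>F[X] / (X\<^sup>2 - s)\<close> (where \<open>y\<close> acts as \<open>t\<close>) and the algebra of \<open>2 \<times> 2\<close> matrices: the matrix
  representation exists over \<open>F\<close> itself because \<open>u\<^sup>2 - u v + v\<^sup>2\<close> represents every element of a finite
  field. The resulting homomorphism into the product of all blocks is injective as \<open>2\<close> and \<open>3\<close> are
  invertible, hence bijective by counting. Finally \<open>F[X] / (X\<^sup>2 - s)\<close> is \<open>F \<times> F\<close> or the field with
  \<open>q\<^sup>2\<close> elements according to whether \<open>s\<close> is a square, and \<open>- 1\<close> is a square iff \<open>q mod 4 = 1\<close>.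
\<close>

section \<open>Powers, products and units of groups\<close>

lemma group_group_power: "group G \<Longrightarrow> group (group_power G n)"
  by (simp add: group_power_def)

text \<open>Covers the multiplicative structures of the quadratic and matrix rings, which are
  monoids and not groups; powers of them are formed before passing to units.\<close>

lemma monoid_group_power:
  assumes "monoid G"
  shows "monoid (group_power G n)"
proof -
  interpret monoid G by fact
  show ?thesis
    by (rule monoidI) (auto simp: group_power_def PiE_iff fun_eq_iff m_assoc extensional_def)
qed

lemma group_power_iso:
  assumes "G \<cong> H"
  shows "group_power G n \<cong> group_power H n"
proof -
  obtain f where f: "f \<in> iso G H" using assms by (auto simp: is_iso_def)
  then have bij: "bij_betw f (carrier G) (carrier H)" and hom: "f \<in> hom G H"
    by (auto simp: iso_def)
  let ?g = "inv_into (carrier G) f"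
  have "(\<lambda>a. \<lambda>i\<in>{..<n}. f (a i)) \<in> iso (group_power G n) (group_power H n)"
  proof (rule isoI)
    show "(\<lambda>a. \<lambda>i\<in>{..<n}. f (a i)) \<in> hom (group_power G n) (group_power H n)"
      using hom by (auto simp: hom_def group_power_def PiE_iff fun_eq_iff restrict_def)
    show "bij_betw (\<lambda>a. \<lambda>i\<in>{..<n}. f (a i)) (carrier (group_power G n)) (carrier (group_power H n))"
      by (rule bij_betw_byWitness[where f' = "\<lambda>b. \<lambda>i\<in>{..<n}. ?g (b i)"])
         (use bij in \<open>auto simp: group_power_def PiE_iff fun_eq_iff extensional_def restrict_def
            bij_betw_inv_into_left bij_betw_inv_into_right bij_betwE bij_betw_def inv_into_into\<close>)
  qed
  then show ?thesis by (auto simp: is_iso_def)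
qed

lemma group_power_DirProd: "group_power (G \<times>\<times> H) n \<cong> group_power G n \<times>\<times> group_power H n"
proof -
  let ?f = "\<lambda>a. (\<lambda>i\<in>{..<n}. fst (a i), \<lambda>i\<in>{..<n}. snd (a i))"
  let ?g = "\<lambda>bc. \<lambda>i\<in>{..<n}. (fst bc i, snd bc i)"
  let ?A = "carrier (group_power (G \<times>\<times> H) n)" and ?B = "carrier (group_power G n \<times>\<times> group_power H n)"
  have f: "?f \<in> hom (group_power (G \<times>\<times> H) n) (group_power G n \<times>\<times> group_power H n)"
    by (rule homI)
       (auto simp: group_power_def mult_DirProd' restrict_def fun_eq_iff PiE_iff mem_Times_iff extensional_def)
  have gf: "?g (?f a) = a" if "a \<in> ?A" for a
  proof -
    from that have "a \<in> extensional {..<n}" by (simp add: group_power_def PiE_iff)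
    then show ?thesis by (simp add: fun_eq_iff extensional_def)
  qed
  have fg: "?f (?g bc) = bc" if "bc \<in> ?B" for bc
  proof -
    from that have "fst bc \<in> extensional {..<n}" "snd bc \<in> extensional {..<n}"
      by (simp_all add: group_power_def PiE_iff mem_Times_iff)
    then show ?thesis by (simp add: fun_eq_iff extensional_def prod_eq_iff)
  qed
  have "bij_betw ?f ?A ?B"
  proof (rule bij_betw_byWitness[where f' = ?g])
    show "?f ` ?A \<subseteq> ?B" using f by (auto simp: hom_def)
    show "?g ` ?B \<subseteq> ?A"
    proof (rule image_subsetI)
      fix bc assume "bc \<in> ?B"
      then have "fst bc i \<in> carrier G" "snd bc i \<in> carrier H" if "i < n" for i
        using that by (auto simp: group_power_def PiE_iff mem_Times_iff)
      then show "?g bc \<in> ?A" by (simp add: group_power_def PiE_iff)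
    qed
  qed (use gf fg in blast)+
  with f show ?thesis unfolding is_iso_def iso_def by blast
qed

lemma group_power_add: "group_power G m \<times>\<times> group_power G n \<cong> group_power G (m + n)"
proof -
  let ?f = "\<lambda>bc. \<lambda>i\<in>{..<m + n}. if i < m then fst bc i else snd bc (i - m)"
  let ?g = "\<lambda>a. (\<lambda>i\<in>{..<m}. a i, \<lambda>i\<in>{..<n}. a (m + i))"
  let ?A = "carrier (group_power G m \<times>\<times> group_power G n)" and ?B = "carrier (group_power G (m + n))"
  have f: "?f \<in> hom (group_power G m \<times>\<times> group_power G n) (group_power G (m + n))"
    by (rule homI) (auto simp: group_power_def mult_DirProd' PiE_iff extensional_def restrict_def fun_eq_iff)
  have gf: "?g (?f bc) = bc" if "bc \<in> ?A" for bc
  proof -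
    from that have "fst bc \<in> extensional {..<m}" "snd bc \<in> extensional {..<n}"
      by (simp_all add: group_power_def PiE_iff mem_Times_iff)
    then show ?thesis by (simp add: fun_eq_iff extensional_def prod_eq_iff)
  qed
  have fg: "?f (?g a) = a" if "a \<in> ?B" for a
  proof -
    from that have "a \<in> extensional {..<m + n}" by (simp add: group_power_def PiE_iff)
    then show ?thesis by (simp add: fun_eq_iff extensional_def)
  qed
  have "bij_betw ?f ?A ?B"
  proof (rule bij_betw_byWitness[where f' = ?g])
    show "?f ` ?A \<subseteq> ?B" using f by (auto simp: hom_def)
    show "?g ` ?B \<subseteq> ?A"
    proof (rule image_subsetI)
      fix a assume "a \<in> ?B"
      then have "a i \<in> carrier G" if "i < m + n" for i
        using that by (auto simp: group_power_def PiE_iff)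
      then show "?g a \<in> ?A" by (simp add: group_power_def PiE_iff)
    qed
  qed (use gf fg in blast)+
  with f show ?thesis unfolding is_iso_def iso_def by blast
qed

text \<open>Merges the unit groups of split quadratic blocks into a single power of a cyclic
  group.\<close>

lemma group_power_square:
  assumes "G \<cong> H \<times>\<times> H"
  shows "group_power G n \<cong> group_power H (n + n)"
  using iso_trans[OF group_power_iso[OF assms] iso_trans[OF group_power_DirProd group_power_add]] .

lemma DirProd_assoc_iso: "G \<times>\<times> (H \<times>\<times> K) \<cong> (G \<times>\<times> H) \<times>\<times> K"
proof -
  have "(\<lambda>(x, y, z). ((x, y), z)) \<in> iso (G \<times>\<times> (H \<times>\<times> K)) ((G \<times>\<times> H) \<times>\<times> K)"
    by (auto simp: iso_def hom_def inj_on_def bij_betw_def image_iff)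
  then show ?thesis by (auto simp: is_iso_def)
qed

section \<open>Unit groups of products, powers and isomorphic monoids\<close>

lemma units_of_DirProd: "units_of (G \<times>\<times> H) = units_of G \<times>\<times> units_of H"
  by (auto simp: units_of_def DirProd_def Units_def)

lemma units_of_group_power: "units_of (group_power G n) = group_power (units_of G) n"
proof -
  have "Units (group_power G n) = (\<Pi>\<^sub>E i\<in>{..<n}. Units G)"
  proof
    show "Units (group_power G n) \<subseteq> (\<Pi>\<^sub>E i\<in>{..<n}. Units G)"
    proof
      fix a assume "a \<in> Units (group_power G n)"
      then obtain b where ab: "a \<in> carrier (group_power G n)" "b \<in> carrier (group_power G n)"
        "b \<otimes>\<^bsub>group_power G n\<^esub> a = \<one>\<^bsub>group_power G n\<^esub>"
        "a \<otimes>\<^bsub>group_power G n\<^esub> b = \<one>\<^bsub>group_power G n\<^esub>"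
        by (auto simp: Units_def)
      show "a \<in> (\<Pi>\<^sub>E i\<in>{..<n}. Units G)"
      proof (rule PiE_I)
        fix i assume i: "i \<in> {..<n}"
        have "b i \<otimes>\<^bsub>G\<^esub> a i = \<one>\<^bsub>G\<^esub>" "a i \<otimes>\<^bsub>G\<^esub> b i = \<one>\<^bsub>G\<^esub>"
          using fun_cong[OF ab(3), of i] fun_cong[OF ab(4), of i] i by (simp_all add: group_power_def)
        moreover have "a i \<in> carrier G" "b i \<in> carrier G"
          using ab(1,2) i by (auto simp: group_power_def)
        ultimately show "a i \<in> Units G" by (auto simp: Units_def)
      qed (use ab(1) in \<open>auto simp: group_power_def\<close>)
    qed
    show "(\<Pi>\<^sub>E i\<in>{..<n}. Units G) \<subseteq> Units (group_power G n)"
    proof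
      fix a assume a: "a \<in> (\<Pi>\<^sub>E i\<in>{..<n}. Units G)"
      then have "\<forall>i\<in>{..<n}. \<exists>b\<in>carrier G. b \<otimes>\<^bsub>G\<^esub> a i = \<one>\<^bsub>G\<^esub> \<and> a i \<otimes>\<^bsub>G\<^esub> b = \<one>\<^bsub>G\<^esub>"
        by (auto simp: Units_def PiE_iff)
      then obtain b where b: "\<And>i. i < n \<Longrightarrow> b i \<in> carrier G \<and> b i \<otimes>\<^bsub>G\<^esub> a i = \<one>\<^bsub>G\<^esub> \<and> a i \<otimes>\<^bsub>G\<^esub> b i = \<one>\<^bsub>G\<^esub>"
        by (metis lessThan_iff)
      have "a \<in> carrier (group_power G n)"
        using a by (auto simp: group_power_def PiE_iff Units_def)
      moreover have "restrict b {..<n} \<in> carrier (group_power G n)"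
        using b by (auto simp: group_power_def)
      moreover have "restrict b {..<n} \<otimes>\<^bsub>group_power G n\<^esub> a = \<one>\<^bsub>group_power G n\<^esub>"
        "a \<otimes>\<^bsub>group_power G n\<^esub> restrict b {..<n} = \<one>\<^bsub>group_power G n\<^esub>"
        using b by (auto simp: group_power_def restrict_def)
      ultimately show "a \<in> Units (group_power G n)" by (auto simp: Units_def)
    qed
  qed
  then show ?thesis
    by (auto simp: units_of_def group_power_def product_group_def)
qed

text \<open>A multiplicative bijection of monoids fixes the identity by surjectivity, hence carries
  units to units. Rings enter only through their multiplication, so no additivity has to be
  established for the maps.\<close>

lemma units_of_iso:
  assumes M: "monoid M" and N: "monoid N" and h: "h \<in> iso M N"
  shows "units_of M \<cong> units_of N"
proof -
  interpret M: monoid M by fact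
  interpret N: monoid N by fact
  have hom: "h \<in> hom M N" and bij: "bij_betw h (carrier M) (carrier N)" using h by (auto simp: iso_def)
  have mult: "h (x \<otimes>\<^bsub>M\<^esub> y) = h x \<otimes>\<^bsub>N\<^esub> h y" if "x \<in> carrier M" "y \<in> carrier M" for x y
    using hom that by (auto simp: hom_def)
  have closed: "h x \<in> carrier N" if "x \<in> carrier M" for x using hom that by (auto simp: hom_def)
  have surj: "\<exists>x\<in>carrier M. y = h x" if "y \<in> carrier N" for y
    using bij that by (auto simp: bij_betw_def)
  have one: "h \<one>\<^bsub>M\<^esub> = \<one>\<^bsub>N\<^esub>"
  proof -
    \<comment> \<open>With \<open>e\<close> the preimage of the target identity, \<open>h\<close> of
      the source identity equals its product with \<open>h e\<close>, which is \<open>h e\<close>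
      again by multiplicativity.\<close>
    obtain e where e: "e \<in> carrier M" "\<one>\<^bsub>N\<^esub> = h e" using surj N.one_closed by blast
    have "h \<one>\<^bsub>M\<^esub> = h \<one>\<^bsub>M\<^esub> \<otimes>\<^bsub>N\<^esub> h e" using e closed by (metis M.one_closed N.r_one)
    also have "\<dots> = h e" using e by (metis mult M.one_closed M.l_one)
    finally show ?thesis using e by simp
  qed
  have inj: "x = y" if "h x = h y" "x \<in> carrier M" "y \<in> carrier M" for x y
    using bij that by (auto simp: bij_betw_def inj_on_def)
  have U: "h ` Units M = Units N"
  proof
    show "h ` Units M \<subseteq> Units N"
      unfolding Units_def using closed by (force simp: mult[symmetric] one)
    show "Units N \<subseteq> h ` Units M"
    proof
      fix y assume "y \<in> Units N"
      then obtain z where yz: "y \<in> carrier N" "z \<in> carrier N" "z \<otimes>\<^bsub>N\<^esub> y = \<one>\<^bsub>N\<^esub>" "y \<otimes>\<^bsub>N\<^esub> z = \<one>\<^bsub>N\<^esub>"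
        by (auto simp: Units_def)
      then obtain a b where ab: "a \<in> carrier M" "b \<in> carrier M" "y = h a" "z = h b"
        using surj by metis
      with yz have "b \<otimes>\<^bsub>M\<^esub> a = \<one>\<^bsub>M\<^esub>" "a \<otimes>\<^bsub>M\<^esub> b = \<one>\<^bsub>M\<^esub>"
        by (auto simp: mult[symmetric] one[symmetric] dest!: inj)
      with ab show "y \<in> h ` Units M" by (auto simp: Units_def)
    qed
  qed
  have "h \<in> iso (units_of M) (units_of N)"
  proof (rule isoI)
    show "h \<in> hom (units_of M) (units_of N)"
      using U by (auto simp: hom_def units_of_def mult M.Units_closed)
    show "bij_betw h (carrier (units_of M)) (carrier (units_of N))"
      using U bij by (auto simp: bij_betw_def units_of_def inj_on_def M.Units_closed)
  qed
  then show ?thesis by (auto simp: is_iso_def)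
qed

section \<open>Cyclic groups and the units of a finite field\<close>

text \<open>Powers of \<open>a\<close> depend only on the exponent modulo the group order, because
  the order of \<open>a\<close> divides it. The power map from residues is then a surjection between
  finite sets of equal size.\<close>

lemma (in group) cyclic_iso:
  assumes a: "a \<in> carrier G" and gen: "carrier G = {a [^] i | i :: nat. True}"
    and fin: "finite (carrier G)"
  shows "G \<cong> cyclic (Coset.order G)"
proof -
  let ?n = "Coset.order G"
  have n: "?n > 0" using fin by (simp add: order_gt_0_iff_finite)
  let ?f = "\<lambda>z :: int. a [^] z"
  have mod: "a [^] (z mod int ?n) = a [^] z" for z :: int
  proof -
    have "int (ord a) dvd z - z mod int ?n"
      using ord_dvd_group_order[OF a] by (simp add: minus_mod_eq_mult_div dvd_mult2)
    then show ?thesis using int_pow_eq[OF a] by blast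
  qed
  have surj: "?f ` carrier (cyclic ?n) = carrier G"
  proof
    show "?f ` carrier (cyclic ?n) \<subseteq> carrier G" using a by auto
    show "carrier G \<subseteq> ?f ` carrier (cyclic ?n)"
    proof
      fix x assume "x \<in> carrier G"
      then obtain i :: nat where "x = a [^] i" using gen by auto
      then have "x = ?f (int i mod int ?n)" by (simp add: mod int_pow_int)
      moreover have "int i mod int ?n \<in> carrier (cyclic ?n)"
        using n by (simp add: carrier_integer_mod_group)
      ultimately show "x \<in> ?f ` carrier (cyclic ?n)" by blast
    qed
  qed
  have card: "card (carrier (cyclic ?n)) = card (carrier G)" and fin': "finite (carrier (cyclic ?n))"
    using n by (simp_all add: carrier_integer_mod_group Coset.order_def)
  have "?f \<in> iso (cyclic ?n) G"
  proof (rule isoI)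
    show "?f \<in> hom (cyclic ?n) G" using a by (auto simp: hom_def mod int_pow_mult)
    show "bij_betw ?f (carrier (cyclic ?n)) (carrier G)"
      using surj card fin' by (simp add: bij_betw_def eq_card_imp_inj_on)
  qed
  then have "cyclic ?n \<cong> G" by (auto simp: is_iso_def)
  then show ?thesis by (rule group.iso_sym[OF group_integer_mod_group])
qed

text \<open>Every finite field has a primitive element; its powers exhaust the nonzero
  elements.\<close>

lemma finite_field_units:
  assumes "field R" "finite (carrier R)"
  shows "units_of R \<cong> cyclic (card (carrier R) - 1)"
proof -
  interpret field R by fact
  interpret mult: group "units_of R" by (rule units_group)
  have pow: "a [^]\<^bsub>units_of R\<^esub> i = a [^]\<^bsub>R\<^esub> i" for a and i :: nat
    by (simp add: nat_pow_def units_of_def)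
  have carrier: "carrier (units_of R) = carrier R - {\<zero>\<^bsub>R\<^esub>}"
    by (simp add: units_of_def field_Units)
  obtain a where "a \<in> carrier (units_of R)" "carrier (units_of R) = {a [^]\<^bsub>units_of R\<^esub> i | i :: nat. True}"
    using finite_field_mult_group_has_gen[OF assms(2)] unfolding pow carrier by auto
  then have "units_of R \<cong> cyclic (Coset.order (units_of R))"
    by (rule mult.cyclic_iso) (simp add: carrier assms(2))
  moreover have "Coset.order (units_of R) = card (carrier R) - 1"
    by (simp add: Coset.order_def carrier assms(2))
  ultimately show ?thesis by simp
qed

section \<open>Finite fields and their quadratic algebras\<close>

text \<open>The pair \<open>(a, b)\<close> stands for \<open>a + b \<surd>s\<close>, that is, for an element of \<open>F[X] / (X\<^sup>2 - s)\<close>.\<close>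

definition quad_ring :: "'f :: field \<Rightarrow> ('f \<times> 'f) ring" where
  "quad_ring s =
     \<lparr>carrier = UNIV,
      monoid.mult = (\<lambda>(a, b) (c, d). (a * c + s * b * d, a * d + b * c)),
      one = (1, 0), ring.zero = (0, 0),
      ring.add = (\<lambda>(a, b) (c, d). (a + c, b + d))\<rparr>"

lemma quad_ring_simps:
  "carrier (quad_ring s) = UNIV"
  "(a, b) \<otimes>\<^bsub>quad_ring s\<^esub> (c, d) = (a * c + s * b * d, a * d + b * c)"
  "\<one>\<^bsub>quad_ring s\<^esub> = (1, 0)"
  "\<zero>\<^bsub>quad_ring s\<^esub> = (0, 0)"
  "(a, b) \<oplus>\<^bsub>quad_ring s\<^esub> (c, d) = (a + c, b + d)"
  by (simp_all add: quad_ring_def)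

lemma cring_quad_ring: "cring (quad_ring s)"
proof (rule cringI)
  show "abelian_group (quad_ring s)"
  proof (rule abelian_groupI)
    fix x assume "x \<in> carrier (quad_ring s)"
    obtain a b where "x = (a, b)" by (cases x)
    then have "(- a, - b) \<oplus>\<^bsub>quad_ring s\<^esub> x = \<zero>\<^bsub>quad_ring s\<^esub>" by (simp add: quad_ring_simps)
    then show "\<exists>y\<in>carrier (quad_ring s). y \<oplus>\<^bsub>quad_ring s\<^esub> x = \<zero>\<^bsub>quad_ring s\<^esub>"
      by (auto simp: quad_ring_simps(1))
  qed (auto simp: quad_ring_simps split_paired_all)
  show "comm_monoid (quad_ring s)"
    by (rule comm_monoidI) (auto simp: quad_ring_simps split_paired_all algebra_simps)
qed (auto simp: quad_ring_simps split_paired_all algebra_simps)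

text \<open>The conjugate divided by the norm \<open>a ^ 2 - s * b ^ 2\<close> inverts
  \<open>(a, b)\<close>. A vanishing norm with \<open>b\<close> nonzero would make \<open>s\<close>
  the square of \<open>a / b\<close>.\<close>

lemma field_quad_ring:
  assumes "\<And>r. r ^ 2 \<noteq> s"
  shows "field (quad_ring s)"
proof -
  interpret cring "quad_ring s" by (rule cring_quad_ring)
  show ?thesis
  proof (rule cring_fieldI2)
    fix x assume "x \<in> carrier (quad_ring s)" "x \<noteq> \<zero>\<^bsub>quad_ring s\<^esub>"
    obtain a b where x: "x = (a, b)" by (cases x)
    let ?N = "a ^ 2 - s * b ^ 2"
    have N: "?N \<noteq> 0"
    proof
      assume eq: "?N = 0"
      show False
      proof (cases "b = 0")
        case True
        with eq x \<open>x \<noteq> _\<close> show False by (simp add: quad_ring_simps)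
      next
        case False
        with eq have "(a / b) ^ 2 = s" by (simp add: power_divide field_simps)
        with assms show False by blast
      qed
    qed
    then have "x \<otimes>\<^bsub>quad_ring s\<^esub> (a / ?N, - b / ?N) = \<one>\<^bsub>quad_ring s\<^esub>"
      by (simp add: x quad_ring_simps power2_eq_square divide_simps)
    then show "\<exists>y\<in>carrier (quad_ring s). x \<otimes>\<^bsub>quad_ring s\<^esub> y = \<one>\<^bsub>quad_ring s\<^esub>"
      by (auto simp: quad_ring_simps(1))
  qed (simp add: quad_ring_simps)
qed

text \<open>The field on the type \<open>'f\<close> as a record, so that results on fields with a
  carrier apply to it.\<close>

abbreviation type_field :: "'f :: field ring" where
  "type_field \<equiv> ring_of_type_algebra"

lemma field_type_field: "field (type_field :: 'f :: field ring)" by auto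

lemma type_field_simps:
  "carrier type_field = UNIV" "x \<otimes>\<^bsub>type_field\<^esub> y = x * y" "\<one>\<^bsub>type_field\<^esub> = 1" "\<zero>\<^bsub>type_field\<^esub> = 0"
  by (simp_all add: ring_of_type_algebra_def)

lemma type_field_power: "x [^]\<^bsub>type_field\<^esub> (n :: nat) = x ^ n"
  by (induction n) (simp_all add: nat_pow_def ring_of_type_algebra_def mult.commute)

text \<open>This is evaluation at the two roots \<open>r\<close> and \<open>- r\<close> of X^2 -
  r^2. They are distinct as \<open>2 * r\<close> is nonzero, so the half-sum and half-difference of
  the values recover both coordinates.\<close>

lemma quad_ring_split:
  fixes r :: "'f :: field"
  assumes "r \<noteq> 0" "(2 :: 'f) \<noteq> 0"
  shows "(\<lambda>(a, b). (a + r * b, a - r * b)) \<in> iso (quad_ring (r ^ 2)) (type_field \<times>\<times> type_field)"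
proof (rule isoI)
  have four: "(4 :: 'f) \<noteq> 0" using assms(2)
    by (metis mult_eq_0_iff num_double numeral_times_numeral)
  show "(\<lambda>(a, b). (a + r * b, a - r * b)) \<in> hom (quad_ring (r ^ 2)) (type_field \<times>\<times> type_field)"
    by (auto simp: hom_def quad_ring_simps type_field_simps power2_eq_square algebra_simps)
  show "bij_betw (\<lambda>(a, b). (a + r * b, a - r * b)) (carrier (quad_ring (r ^ 2))) (carrier (type_field \<times>\<times> type_field))"
    by (rule bij_betw_byWitness[where f' = "\<lambda>(c, d). ((c + d) / 2, (c - d) / (2 * r))"])
       (use assms four in \<open>auto simp: quad_ring_simps type_field_simps divide_simps\<close>)
qed

lemma units_quad_ring_split:
  fixes r :: "'f :: {field, finite}"
  assumes "r \<noteq> 0" "(2 :: 'f) \<noteq> 0"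
  shows "units_of (quad_ring (r ^ 2)) \<cong> cyclic (CARD('f) - 1) \<times>\<times> cyclic (CARD('f) - 1)"
proof -
  interpret Q: cring "quad_ring (r ^ 2)" by (rule cring_quad_ring)
  interpret F: field "type_field :: 'f ring" by (rule field_type_field)
  have "units_of (type_field :: 'f ring) \<cong> cyclic (CARD('f) - 1)"
    using finite_field_units[OF field_type_field[where 'f = 'f]] by (simp add: type_field_simps)
  then have "units_of ((type_field :: 'f ring) \<times>\<times> (type_field :: 'f ring)) \<cong> cyclic (CARD('f) - 1) \<times>\<times> cyclic (CARD('f) - 1)"
    unfolding units_of_DirProd by (intro group.DirProd_iso_trans F.units_group)
  moreover have "units_of (quad_ring (r ^ 2)) \<cong> units_of ((type_field :: 'f ring) \<times>\<times> (type_field :: 'f ring))"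
    by (rule units_of_iso[OF Q.monoid_axioms _ quad_ring_split[OF assms]])
       (rule DirProd_monoid[OF F.monoid_axioms F.monoid_axioms])
  ultimately show ?thesis by (rule iso_trans[rotated])
qed

lemma units_quad_ring_field:
  fixes s :: "'f :: {field, finite}"
  assumes "\<And>r. r ^ 2 \<noteq> s"
  shows "units_of (quad_ring s) \<cong> cyclic (CARD('f) ^ 2 - 1)"
  using finite_field_units[OF field_quad_ring[OF assms]]
  by (simp add: quad_ring_simps power2_eq_square)

section \<open>Squares in a finite field\<close>

lemma finite_field_power_card_minus_1:
  fixes x :: "'f :: {field, finite}"
  assumes "x \<noteq> 0"
  shows "x ^ (CARD('f) - 1) = 1"
proof -
  interpret field "type_field :: 'f ring" by (rule field_type_field)
  interpret U: group "units_of (type_field :: 'f ring)" by (rule units_group)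
  have U: "carrier (units_of (type_field :: 'f ring)) = UNIV - {0}"
    by (simp add: units_of_def field_Units type_field_simps)
  have "x [^]\<^bsub>units_of type_field\<^esub> Coset.order (units_of (type_field :: 'f ring)) = 1"
    using U.pow_order_eq_1[of x] assms U by (simp add: units_of_one type_field_simps)
  moreover have "Coset.order (units_of (type_field :: 'f ring)) = CARD('f) - 1"
    using U by (simp add: Coset.order_def)
  moreover have "x [^]\<^bsub>units_of type_field\<^esub> n = x ^ n" for n :: nat
    using U by (simp add: nat_pow_def units_of_def type_field_power[unfolded nat_pow_def])
  ultimately show ?thesis by simp
qed

text \<open>If \<open>r ^ 2 = - 1\<close>, raising to the power (q - 1) / 2 turns
  \<open>r ^ (q - 1) = 1\<close> into a condition on the parity of that exponent. Conversely, a
  suitable power of a nonzero element outside the roots of X^((q - 1) / 2) - 1 is a square root of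
  -1.\<close>

lemma minus_one_square_iff:
  assumes odd: "odd CARD('f :: {field, finite})" and two: "(2 :: 'f) \<noteq> 0"
  shows "(\<exists>r :: 'f. r ^ 2 = - 1) \<longleftrightarrow> CARD('f) mod 4 = 1"
proof
  assume "\<exists>r :: 'f. r ^ 2 = - 1"
  then obtain r :: 'f where r: "r ^ 2 = - 1" by blast
  then have "r \<noteq> 0" by auto
  obtain n where n: "CARD('f) - 1 = 2 * n" using odd by (auto elim: oddE)
  have "(- 1 :: 'f) ^ n = 1"
    using finite_field_power_card_minus_1[OF \<open>r \<noteq> 0\<close>] unfolding n power_mult r .
  then have "even n" using two by (cases "even n") (auto simp: minus_equation_iff eq_neg_iff_add_eq_0)
  then show "CARD('f) mod 4 = 1" using n odd by (auto elim!: evenE oddE)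
next
  assume "CARD('f) mod 4 = 1"
  moreover have "CARD('f) > 1" using card_mono[of UNIV "{0, 1 :: 'f}"] by simp
  moreover define m where "m = CARD('f) div 4"
  ultimately have m: "CARD('f) - 1 = 4 * m" "m > 0" by presburger+
  interpret field "type_field :: 'f ring" by (rule field_type_field)
  \<comment> \<open>X^(2m) - 1 has at most 2m roots, while there are 4m nonzero elements. An element
    \<open>x\<close> that is not a root has \<open>x ^ (2 * m)\<close> squaring to 1 without being
    1.\<close>
  have "card {x :: 'f. x ^ (2 * m) = 1} \<le> 2 * m"
    using num_roots_le_deg[of "2 * m"] m(2) by (simp add: type_field_simps type_field_power)
  also have "\<dots> < card (UNIV - {0 :: 'f})" using m by simp
  finally have "\<not> UNIV - {0 :: 'f} \<subseteq> {x. x ^ (2 * m) = 1}"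
    by (metis card_mono finite leD)
  then obtain x :: 'f where x: "x \<noteq> 0" "x ^ (2 * m) \<noteq> 1" by blast
  have "(x ^ (2 * m)) ^ 2 = 1"
    using finite_field_power_card_minus_1[OF x(1)] unfolding m(1) by (simp flip: power_mult add: mult_ac)
  with x(2) have "x ^ (2 * m) = - 1" by (simp only: power2_eq_1_iff simp_thms)
  then have "(x ^ m) ^ 2 = - 1" by (simp add: mult.commute flip: power_mult)
  then show "\<exists>r :: 'f. r ^ 2 = - 1" by blast
qed

text \<open>Fibres of squaring have at most two elements, and the fibre over 0 has exactly one,
  which makes the inequality strict.\<close>

lemma card_squares: "CARD('f :: {field, finite}) < 2 * card (range (\<lambda>a :: 'f. a ^ 2))"
proof -
  let ?S = "range (\<lambda>a :: 'f. a ^ 2)"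
  have "CARD('f) = card (\<Union>y\<in>?S. {x :: 'f. x ^ 2 = y})" by (rule arg_cong[of _ _ card]) auto
  also have "\<dots> \<le> (\<Sum>y\<in>?S. card {x :: 'f. x ^ 2 = y})" by (rule card_UN_le) simp
  also have "\<dots> < (\<Sum>y\<in>?S. 2)"
  proof (rule sum_strict_mono_ex1)
    show "\<forall>y\<in>?S. card {x :: 'f. x ^ 2 = y} \<le> 2"
    proof safe
      fix a :: 'f
      have "{x. x ^ 2 = a ^ 2} = {a, - a}" by (auto simp: power2_eq_iff)
      then show "card {x. x ^ 2 = a ^ 2} \<le> 2" by (simp add: card_insert_if)
    qed
    have "{x :: 'f. x ^ 2 = 0} = {0}" by auto
    then show "\<exists>y\<in>?S. card {x :: 'f. x ^ 2 = y} < 2" by (intro bexI[of _ 0]) (auto intro: image_eqI[of _ _ 0])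
  qed simp
  finally show ?thesis by simp
qed

lemma ex_norm_form:
  fixes s :: "'f :: {field, finite}"
  assumes "(3 :: 'f) \<noteq> 0"
  shows "\<exists>u v. u ^ 2 - u * v + v ^ 2 = s"
proof -
  \<comment> \<open>With \<open>u = a + b\<close> and \<open>v = 2 b\<close> the form becomes \<open>a\<^sup>2 + 3 b\<^sup>2\<close>; more than half of the
    field elements are squares, so \<open>a\<^sup>2\<close> and \<open>s - 3 b\<^sup>2\<close> must meet.\<close>
  let ?S = "range (\<lambda>a :: 'f. a ^ 2)"
  have "card ((\<lambda>y. s - 3 * y) ` ?S) = card ?S"
    using assms by (intro card_image) (auto simp: inj_on_def)
  have "?S \<inter> (\<lambda>y. s - 3 * y) ` ?S \<noteq> {}"
  proof
    assume "?S \<inter> (\<lambda>y. s - 3 * y) ` ?S = {}"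
    then have "card (?S \<union> (\<lambda>y. s - 3 * y) ` ?S) = card ?S + card ?S"
      using \<open>card _ = card ?S\<close> by (subst card_Un_disjoint) auto
    moreover have "card (?S \<union> (\<lambda>y. s - 3 * y) ` ?S) \<le> CARD('f)" by (rule card_mono) auto
    ultimately show False using card_squares[where 'f = 'f] by simp
  qed
  then obtain a b where "a ^ 2 = s - 3 * b ^ 2" by auto
  then have "(a + b) ^ 2 - (a + b) * (2 * b) + (2 * b) ^ 2 = s"
    by (simp add: power2_eq_square algebra_simps)
  then show ?thesis by blast
qed

section \<open>Representations of the group algebra\<close>

text \<open>The relation says that moving \<open>y\<close> past \<open>x\<close> inverts it. The
  inverse is written \<open>y [^] 5\<close>, so exponents stay natural numbers and the same formula
  holds in the group and in the multiplicative monoid of a ring.\<close>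

lemma (in monoid) pow_mult_pow_conj:
  assumes xy: "x \<in> carrier G" "y \<in> carrier G" and y6: "y [^] (6 :: nat) = \<one>" and yxy: "y \<otimes> x \<otimes> y = x"
  shows "(x [^] i \<otimes> y [^] j) \<otimes> (x [^] k \<otimes> y [^] l) = x [^] (i + k) \<otimes> y [^] (j * 5 ^ k + l :: nat)"
proof -
  have "y \<otimes> y [^] (5 :: nat) = \<one>" using xy y6 nat_pow_Suc2[of y 5] by simp
  then have "y \<otimes> x = y \<otimes> x \<otimes> (y \<otimes> y [^] (5 :: nat))" using xy by simp
  also have "\<dots> = x \<otimes> y [^] (5 :: nat)" using xy yxy by (simp flip: m_assoc)
  finally have yx: "y \<otimes> x = x \<otimes> y [^] (5 :: nat)" .
  have ynx: "y [^] n \<otimes> x = x \<otimes> y [^] (n * 5)" for n :: nat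
  proof (induction n)
    case (Suc n)
    have "y [^] Suc n \<otimes> x = y [^] n \<otimes> x \<otimes> y [^] (5 :: nat)" using xy by (simp add: m_assoc yx)
    also have "\<dots> = x \<otimes> y [^] (Suc n * 5)" using xy by (simp add: Suc m_assoc nat_pow_mult add.commute)
    finally show ?case .
  qed (use xy in simp)
  have ynxk: "y [^] n \<otimes> x [^] k = x [^] k \<otimes> y [^] (n * 5 ^ k)" for n k :: nat
  proof (induction k)
    case (Suc k)
    have "y [^] n \<otimes> x [^] Suc k = x [^] k \<otimes> (y [^] (n * 5 ^ k) \<otimes> x)"
      using xy by (simp add: Suc flip: m_assoc)
    also have "\<dots> = x [^] Suc k \<otimes> y [^] (n * 5 ^ Suc k)"
      using xy by (simp add: ynx mult_ac flip: m_assoc)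
    finally show ?case .
  qed (use xy in simp)
  have "(x [^] i \<otimes> y [^] j) \<otimes> (x [^] k \<otimes> y [^] l) = x [^] i \<otimes> (y [^] j \<otimes> x [^] k) \<otimes> y [^] l"
    using xy by (simp add: m_assoc)
  also have "\<dots> = x [^] i \<otimes> x [^] k \<otimes> (y [^] (j * 5 ^ k) \<otimes> y [^] l)"
    using xy by (simp add: ynxk m_assoc)
  finally show ?thesis using xy by (simp add: nat_pow_mult)
qed

lemma (in monoid) pow_mod_eq:
  assumes "x \<in> carrier G" "x [^] (n :: nat) = \<one>"
  shows "x [^] (m mod n) = x [^] m"
proof -
  have "x [^] m = x [^] (n * (m div n) + m mod n)" by simp
  also have "\<dots> = x [^] (m mod n)"
    using assms by (simp only: nat_pow_mult[symmetric] nat_pow_pow[symmetric]) simp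
  finally show ?thesis by simp
qed

text \<open>Rewriting words by the relators reaches some x^a y^b with a < 4 and b < 6, so the 24
  exponent pairs map onto the group. Since the group has order 24, the map is also
  injective.\<close>

lemma C6_C4_normal_form:
  fixes G :: "('a, 'm) monoid_scheme" (structure)
  assumes G: "is_C6_rtimes_C4 G"
  obtains x y where "x \<in> carrier G" "y \<in> carrier G" "x [^] (4 :: nat) = \<one>" "y [^] (6 :: nat) = \<one>"
    "y \<otimes> x \<otimes> y = x"
    "bij_betw (\<lambda>(i, j). x [^] i \<otimes> y [^] j) ({..<4 :: nat} \<times> {..<6 :: nat}) (carrier G)"
proof -
  from G obtain f :: "gen_xy \<Rightarrow> 'a" where card: "card (carrier G) = 24" and "group G"
    and f: "range f \<subseteq> carrier G" and gen: "generate G (range f) = carrier G"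
    and rel: "\<And>w. word_val G f w = \<one> \<longleftrightarrow> word_cong C6_C4_relators w []"
    by (auto simp: is_C6_rtimes_C4_def has_presentation_def Coset.order_def)
  interpret group G by fact
  define x y where "x = f Gen_x" and "y = f Gen_y"
  have xy: "x \<in> carrier G" "y \<in> carrier G" using f by (auto simp: x_def y_def)
  have relator: "word_val G f r = \<one>" if "r \<in> C6_C4_relators" for r
    using word_cong.relator[OF that, of "[]" "[]"] rel by simp
  have val_x: "word_val G f (replicate n (Gen_x, False) @ w) = x [^] n \<otimes> word_val G f w" for n w
    using xy nat_pow_Suc2[of x]
    by (induction n) (simp_all add: x_def m_assoc word_val_closed[OF is_group f] del: nat_pow_Suc)
  have val_y: "word_val G f (replicate n (Gen_y, False)) = y [^] n" for n
    using xy nat_pow_Suc2[of y] by (induction n) (simp_all add: y_def del: nat_pow_Suc)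
  have x4: "x [^] (4 :: nat) = \<one>"
    using relator[of "replicate 4 (Gen_x, False)"] val_x[of 4 "[]"] xy by (simp add: C6_C4_relators_def)
  have y6: "y [^] (6 :: nat) = \<one>"
    using relator[of "replicate 6 (Gen_y, False)"] val_y[of 6] by (simp add: C6_C4_relators_def)
  have "word_val G f [(Gen_y, False), (Gen_x, False), (Gen_y, False), (Gen_x, True)] = \<one>"
    by (rule relator) (simp add: C6_C4_relators_def)
  then have "y \<otimes> x \<otimes> y \<otimes> inv x = \<one>" using xy by (simp add: x_def y_def m_assoc)
  then have yxy: "y \<otimes> x \<otimes> y = x" using xy by (metis inv_solve_right' l_one m_closed one_closed)
  let ?e = "\<lambda>(i, j). x [^] i \<otimes> y [^] j" and ?I = "{..<4 :: nat} \<times> {..<6 :: nat}"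
  \<comment> \<open>Induction over the generated subgroup: each of its elements is the value of a
    word, and words can be reduced.\<close>
  have "\<exists>w. g = word_val G f w" if "g \<in> generate G (range f)" for g
    using that
  proof induction
    case one
    show ?case by (intro exI[of _ "[]"]) simp
  next
    case (incl h)
    then obtain l where "h = f l" "f l \<in> carrier G" using f by blast
    then show ?case by (intro exI[of _ "[(l, False)]"]) auto
  next
    case (inv h)
    then obtain l where "h = f l" "f l \<in> carrier G" using f by blast
    then show ?case by (intro exI[of _ "[(l, True)]"]) auto
  next
    case (eng h1 h2)
    then show ?case using word_val_append[OF is_group f] by metis
  qed
  moreover have "word_val G f w \<in> ?e ` ?I" for w
  proof -
    obtain a b where "word_cong C6_C4_relators w (nf (a mod 4) (b mod 6))"
      using ex_nf nf_mod word_cong.trans by metis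
    then have "word_val G f w = word_val G f (nf (a mod 4) (b mod 6))"
      by (intro word_val_cong[OF is_group f relator])
    then have "word_val G f w = ?e (a mod 4, b mod 6)" by (simp add: nf_def val_x val_y)
    then show ?thesis by (intro image_eqI[of _ _ "(a mod 4, b mod 6)"]) auto
  qed
  ultimately have "carrier G \<subseteq> ?e ` ?I" unfolding gen[symmetric] by blast
  then have surj: "?e ` ?I = carrier G" using xy by auto
  then have "bij_betw ?e ?I (carrier G)"
    by (simp add: bij_betw_def card card_cartesian_product eq_card_imp_inj_on)
  with that xy x4 y6 yxy show thesis by blast
qed

text \<open>The universal property of the presentation, obtained from normal forms: both sides
  multiply them by the formula of \<open>pow_mult_pow_conj\<close>. The target is only a monoid
  because it will be the multiplicative part of a ring.\<close>

lemma C6_C4_hom_extend: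
  fixes G (structure) and M (structure)
  assumes "group G" and xy: "x \<in> carrier G" "y \<in> carrier G" "x [^] (4 :: nat) = \<one>" "y [^] (6 :: nat) = \<one>"
    "y \<otimes> x \<otimes> y = x"
    and bij: "bij_betw (\<lambda>(i, j). x [^] i \<otimes> y [^] j) ({..<4 :: nat} \<times> {..<6 :: nat}) (carrier G)"
    and "monoid M" and uv: "u \<in> carrier M" "v \<in> carrier M"
    "u [^]\<^bsub>M\<^esub> (4 :: nat) = \<one>\<^bsub>M\<^esub>" "v [^]\<^bsub>M\<^esub> (6 :: nat) = \<one>\<^bsub>M\<^esub>" "v \<otimes>\<^bsub>M\<^esub> u \<otimes>\<^bsub>M\<^esub> v = u"
  obtains \<rho> where "\<rho> \<in> hom G M" "\<And>(i :: nat) (j :: nat). \<rho> (x [^] i \<otimes> y [^] j) = u [^]\<^bsub>M\<^esub> i \<otimes>\<^bsub>M\<^esub> v [^]\<^bsub>M\<^esub> j"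
proof -
  interpret group G by fact
  interpret M: monoid M by fact
  let ?e = "\<lambda>(i, j). x [^] i \<otimes> y [^] j" and ?I = "{..<4 :: nat} \<times> {..<6 :: nat}"
  let ?d = "\<lambda>(i, j). u [^]\<^bsub>M\<^esub> i \<otimes>\<^bsub>M\<^esub> v [^]\<^bsub>M\<^esub> j"
  define \<rho> where "\<rho> = ?d \<circ> inv_into ?I ?e"
  \<comment> \<open>The definition reads off reduced exponents; the equation extends to all
    exponents because both pairs of generators have powers of period 4 and 6.\<close>
  have \<rho>: "\<rho> (x [^] i \<otimes> y [^] j) = u [^]\<^bsub>M\<^esub> i \<otimes>\<^bsub>M\<^esub> v [^]\<^bsub>M\<^esub> j" for i j :: nat
  proof -
    have "x [^] i \<otimes> y [^] j = ?e (i mod 4, j mod 6)"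
      using xy by (simp add: pow_mod_eq)
    moreover have "inv_into ?I ?e (?e (i mod 4, j mod 6)) = (i mod 4, j mod 6)"
      using bij by (intro inv_into_f_f) (auto simp: bij_betw_def)
    ultimately show ?thesis using uv by (simp add: \<rho>_def M.pow_mod_eq)
  qed
  have ex: "\<exists>(i :: nat) (j :: nat). g = x [^] i \<otimes> y [^] j" if "g \<in> carrier G" for g
  proof -
    have "g \<in> ?e ` ?I" using that bij by (simp add: bij_betw_def)
    then show ?thesis by auto
  qed
  have "\<rho> \<in> hom G M"
  proof (rule homI)
    fix g assume "g \<in> carrier G"
    then show "\<rho> g \<in> carrier M" using ex[of g] uv by (auto simp: \<rho>)
  next
    fix g h assume "g \<in> carrier G" "h \<in> carrier G"
    then obtain i j k l :: nat where "g = x [^] i \<otimes> y [^] j" "h = x [^] k \<otimes> y [^] l" using ex by metis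
    then show "\<rho> (g \<otimes> h) = \<rho> g \<otimes>\<^bsub>M\<^esub> \<rho> h"
      using xy uv by (simp add: pow_mult_pow_conj M.pow_mult_pow_conj \<rho>)
  qed
  with \<rho> that show thesis by blast
qed

section \<open>Linear extension from the group to the group algebra\<close>

text \<open>The values of \<open>r\<close> are scalars: a representation by pairs or matrices is
  extended one coordinate at a time, so all sums stay in the field type.\<close>

definition lin_ext :: "('g, 'm) monoid_scheme \<Rightarrow> ('g \<Rightarrow> 'f) \<Rightarrow> ('g \<Rightarrow> 'f) \<Rightarrow> 'f :: field" where
  "lin_ext G r a = (\<Sum>g\<in>carrier G. a g * r g)"

text \<open>Substituting \<open>k = g \<otimes> h\<close> in the convolution gives a double sum that
  can be compared with products of extensions.\<close>

lemma lin_ext_mult: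
  fixes G (structure) and a b :: "'g \<Rightarrow> 'f :: field"
  assumes "group G"
  shows "lin_ext G r (a \<otimes>\<^bsub>group_algebra G\<^esub> b) = (\<Sum>g\<in>carrier G. \<Sum>h\<in>carrier G. a g * b h * r (g \<otimes> h))"
proof -
  interpret group G by fact
  have "lin_ext G r (a \<otimes>\<^bsub>group_algebra G\<^esub> b) =
      (\<Sum>k\<in>carrier G. \<Sum>g\<in>carrier G. a g * b (inv g \<otimes> k) * r k)"
    by (simp add: lin_ext_def group_algebra_def sum_distrib_right)
  also have "\<dots> = (\<Sum>g\<in>carrier G. \<Sum>k\<in>carrier G. a g * b (inv g \<otimes> k) * r k)"
    by (rule sum.swap)
  also have "\<dots> = (\<Sum>g\<in>carrier G. \<Sum>h\<in>carrier G. a g * b h * r (g \<otimes> h))"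
  proof (rule sum.cong[OF HOL.refl])
    fix g assume g: "g \<in> carrier G"
    show "(\<Sum>k\<in>carrier G. a g * b (inv g \<otimes> k) * r k) = (\<Sum>h\<in>carrier G. a g * b h * r (g \<otimes> h))"
      by (rule sum.reindex_bij_witness[of _ "\<lambda>h. g \<otimes> h" "\<lambda>k. inv g \<otimes> k"])
         (use g in \<open>auto simp: inv_solve_left' simp flip: m_assoc\<close>)
  qed
  finally show ?thesis .
qed

lemma lin_ext_prod:
  "lin_ext G u a * lin_ext G v b = (\<Sum>g\<in>carrier G. \<Sum>h\<in>carrier G. a g * b h * (u g * v h))"
  by (simp add: lin_ext_def sum_product mult_ac)

text \<open>Coordinates of a product in \<open>quad_ring s\<close> are bilinear in those of the
  factors, so multiplicativity passes from group elements to linear combinations.\<close>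

lemma lin_ext_quad_hom:
  assumes G: "group G" and \<rho>: "\<rho> \<in> hom G (quad_ring s)"
  shows "(\<lambda>a. (lin_ext G (fst \<circ> \<rho>) a, lin_ext G (snd \<circ> \<rho>) a)) \<in> hom (group_algebra G) (quad_ring s)"
proof (rule homI)
  fix a b
  have mult: "fst (\<rho> (g \<otimes>\<^bsub>G\<^esub> h)) = fst (\<rho> g) * fst (\<rho> h) + s * (snd (\<rho> g) * snd (\<rho> h))"
    "snd (\<rho> (g \<otimes>\<^bsub>G\<^esub> h)) = fst (\<rho> g) * snd (\<rho> h) + snd (\<rho> g) * fst (\<rho> h)"
    if "g \<in> carrier G" "h \<in> carrier G" for g h
    using that \<rho> by (auto simp: hom_def quad_ring_def split_beta)
  show "(lin_ext G (fst \<circ> \<rho>) (a \<otimes>\<^bsub>group_algebra G\<^esub> b), lin_ext G (snd \<circ> \<rho>) (a \<otimes>\<^bsub>group_algebra G\<^esub> b)) =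
    (lin_ext G (fst \<circ> \<rho>) a, lin_ext G (snd \<circ> \<rho>) a) \<otimes>\<^bsub>quad_ring s\<^esub>
    (lin_ext G (fst \<circ> \<rho>) b, lin_ext G (snd \<circ> \<rho>) b)"
    by (simp add: quad_ring_simps lin_ext_mult[OF G] lin_ext_prod mult mult.assoc[of s] sum_distrib_left
        distrib_left sum.distrib mult.left_commute[of s])
qed (simp add: quad_ring_simps)

text \<open>The same bilinearity argument, with the sum over the inner matrix index moved outside
  the sums over the group.\<close>

lemma lin_ext_mat_hom:
  fixes \<rho> :: "'g \<Rightarrow> 'f :: field mat"
  assumes G: "group G" and \<rho>: "\<rho> \<in> hom G (ring_mat TYPE('f) n ())"
  shows "(\<lambda>a. mat n n (\<lambda>ij. lin_ext G (\<lambda>g. \<rho> g $$ ij) a)) \<in> hom (group_algebra G) (ring_mat TYPE('f) n ())"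
proof (rule homI)
  fix a b
  have closed: "\<rho> g \<in> carrier_mat n n" if "g \<in> carrier G" for g
    using that \<rho> by (auto simp: hom_def ring_mat_simps)
  have mult: "\<rho> (g \<otimes>\<^bsub>G\<^esub> h) $$ (i, j) = (\<Sum>k<n. \<rho> g $$ (i, k) * \<rho> h $$ (k, j))"
    if "g \<in> carrier G" "h \<in> carrier G" "i < n" "j < n" for g h i j
    using that \<rho> closed[of g] closed[of h]
    by (auto simp: hom_def ring_mat_simps scalar_prod_def atLeast0LessThan)
  show "mat n n (\<lambda>ij. lin_ext G (\<lambda>g. \<rho> g $$ ij) (a \<otimes>\<^bsub>group_algebra G\<^esub> b)) =
    mat n n (\<lambda>ij. lin_ext G (\<lambda>g. \<rho> g $$ ij) a) \<otimes>\<^bsub>ring_mat TYPE('f) n ()\<^esub>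
    mat n n (\<lambda>ij. lin_ext G (\<lambda>g. \<rho> g $$ ij) b)"
  proof (rule eq_matI)
    fix i j assume "i < dim_row (mat n n (\<lambda>ij. lin_ext G (\<lambda>g. \<rho> g $$ ij) a) \<otimes>\<^bsub>ring_mat TYPE('f) n ()\<^esub>
      mat n n (\<lambda>ij. lin_ext G (\<lambda>g. \<rho> g $$ ij) b))"
      "j < dim_col (mat n n (\<lambda>ij. lin_ext G (\<lambda>g. \<rho> g $$ ij) a) \<otimes>\<^bsub>ring_mat TYPE('f) n ()\<^esub>
      mat n n (\<lambda>ij. lin_ext G (\<lambda>g. \<rho> g $$ ij) b))"
    then have ij: "i < n" "j < n" by (simp_all add: ring_mat_simps)
    have "lin_ext G (\<lambda>g. \<rho> g $$ (i, j)) (a \<otimes>\<^bsub>group_algebra G\<^esub> b) =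
        (\<Sum>g\<in>carrier G. \<Sum>h\<in>carrier G. \<Sum>k<n. a g * b h * (\<rho> g $$ (i, k) * \<rho> h $$ (k, j)))"
      by (simp add: lin_ext_mult[OF G] mult ij sum_distrib_left)
    also have "\<dots> = (\<Sum>k<n. \<Sum>g\<in>carrier G. \<Sum>h\<in>carrier G. a g * b h * (\<rho> g $$ (i, k) * \<rho> h $$ (k, j)))"
      by (subst sum.swap, subst (2) sum.swap) (rule HOL.refl)
    finally show "mat n n (\<lambda>ij. lin_ext G (\<lambda>g. \<rho> g $$ ij) (a \<otimes>\<^bsub>group_algebra G\<^esub> b)) $$ (i, j) =
      (mat n n (\<lambda>ij. lin_ext G (\<lambda>g. \<rho> g $$ ij) a) \<otimes>\<^bsub>ring_mat TYPE('f) n ()\<^esub>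
       mat n n (\<lambda>ij. lin_ext G (\<lambda>g. \<rho> g $$ ij) b)) $$ (i, j)"
      using ij by (simp add: ring_mat_simps scalar_prod_def atLeast0LessThan lin_ext_prod)
  qed (simp_all add: ring_mat_simps)
qed (simp add: ring_mat_simps)

section \<open>Explicit matrices and the linear equations of one block\<close>

definition mat2 :: "'a \<Rightarrow> 'a \<Rightarrow> 'a \<Rightarrow> 'a \<Rightarrow> 'a mat" where
  "mat2 a b c d = mat 2 2 (\<lambda>(i, j). if i = 0 then if j = 0 then a else b else if j = 0 then c else d)"

lemma mat2_simps [simp]:
  "mat2 a b c d \<in> carrier_mat 2 2"
  "mat2 a b c d $$ (0, 0) = a" "mat2 a b c d $$ (0, Suc 0) = b"
  "mat2 a b c d $$ (Suc 0, 0) = c" "mat2 a b c d $$ (Suc 0, Suc 0) = d"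
  by (simp_all add: mat2_def)

lemma mat2_mult:
  fixes a :: "'a :: comm_ring_1"
  shows "mat2 a b c d * mat2 a' b' c' d' =
    mat2 (a * a' + b * c') (a * b' + b * d') (c * a' + d * c') (c * b' + d * d')"
  by (rule eq_matI) (auto simp: mat2_def scalar_prod_def less_2_cases_iff sum.atLeast0_lessThan_Suc numeral_2_eq_2)

lemma mat2_one: "1\<^sub>m 2 = mat2 1 0 0 (1 :: 'a :: comm_ring_1)"
  by (rule eq_matI) (auto simp: mat2_def less_2_cases_iff)

lemma lin_ext_C6_C4:
  fixes G (structure)
  assumes "bij_betw (\<lambda>(i, j). x [^] i \<otimes> y [^] j) ({..<4 :: nat} \<times> {..<6 :: nat}) (carrier G)"
  shows "lin_ext G r a = (\<Sum>i<4 :: nat. \<Sum>j<6 :: nat. a (x [^] i \<otimes> y [^] j) * r (x [^] i \<otimes> y [^] j))"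
  unfolding lin_ext_def sum.reindex_bij_betw[OF assms, symmetric]
  by (simp add: sum.cartesian_product split_beta)

lemma sum_4_6:
  fixes f :: "nat \<Rightarrow> nat \<Rightarrow> 'a :: comm_monoid_add"
  shows "(\<Sum>i<4. \<Sum>j<6. f i j) =
    (f 0 0 + f 0 1 + f 0 2 + f 0 3 + f 0 4 + f 0 5) + (f 1 0 + f 1 1 + f 1 2 + f 1 3 + f 1 4 + f 1 5) +
    (f 2 0 + f 2 1 + f 2 2 + f 2 3 + f 2 4 + f 2 5) + (f 3 0 + f 3 1 + f 3 2 + f 3 3 + f 3 4 + f 3 5)"
  by (simp add: eval_nat_numeral add.assoc)

text \<open>
  \<open>A\<^sub>j\<close> and \<open>B\<^sub>j\<close> are the coefficients of \<open>y\<^sup>j\<close> and \<open>x y\<^sup>j\<close> in a block, with signs absorbed so that \<open>y\<^sup>3 = 1\<close>.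
  Modulo \<open>y\<^sup>2 = - 1 - y\<close> their images are \<open>p + q y\<close> and \<open>x (p' + q' y)\<close>; multiplication by
  \<open>u + v y\<close> is injective because its determinant is \<open>u\<^sup>2 - u v + v\<^sup>2\<close>.
\<close>

lemma block_solve:
  fixes u v :: "'f :: field"
  assumes N: "u ^ 2 - u * v + v ^ 2 \<noteq> 0" and three: "(3 :: 'f) \<noteq> 0"
    and A: "A0 + A1 + A2 = 0" and B: "B0 + B1 + B2 = 0"
    and eqs: "(A0 - A2) + (u * (B1 - B2) + v * (B0 - B2) - v * (B1 - B2)) = 0"
      "- (A1 - A2) + (u * (B0 - B2) - v * (B1 - B2)) - (u * (B1 - B2) + v * (B0 - B2) - v * (B1 - B2)) = 0"
      "(A1 - A2) + (u * (B0 - B2) - v * (B1 - B2)) = 0"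
      "(A0 - A2) - (A1 - A2) - (u * (B1 - B2) + v * (B0 - B2) - v * (B1 - B2)) = 0"
  shows "A0 = 0 \<and> A1 = 0 \<and> A2 = 0 \<and> B0 = 0 \<and> B1 = 0 \<and> B2 = 0"
proof -
  have zero: "x = 0" if "3 * x = 0" for x :: 'f using that three by simp
  define p q p' q' where pq: "p = A0 - A2" "q = A1 - A2" "p' = B0 - B2" "q' = B1 - B2"
  \<comment> \<open>\<open>P + Q y\<close> is the product of \<open>u + v y\<close> and
    \<open>p' + q' y\<close> modulo \<open>y\<^sup>2 = - 1 - y\<close>. The four equations are the
    matrix entries of \<open>p + q y\<close> plus the coordinate swap applied to
    \<open>P + Q y\<close>.\<close>
  define P Q where PQ: "P = u * p' - v * q'" "Q = u * q' + v * p' - v * q'"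
  have e: "p + Q = 0" "- q + P - Q = 0" "q + P = 0" "p - q - Q = 0"
    using eqs unfolding PQ pq by simp_all
  have "3 * Q = (- q + P - Q) - (q + P) - 2 * ((p - q - Q) - (p + Q))" by (simp add: algebra_simps)
  then have "3 * Q = 0" unfolding e by simp
  then have "Q = 0" by (rule zero)
  then have "p = 0" "q = 0" "P = 0" using e by auto
  \<comment> \<open>This is the adjugate of the matrix of multiplication by \<open>u + v y\<close>,
    applied to \<open>(P, Q)\<close>.\<close>
  have "(u ^ 2 - u * v + v ^ 2) * p' = (u - v) * P + v * Q" "(u ^ 2 - u * v + v ^ 2) * q' = u * Q - v * P"
    by (simp_all add: PQ power2_eq_square algebra_simps)
  then have "(u ^ 2 - u * v + v ^ 2) * p' = 0" "(u ^ 2 - u * v + v ^ 2) * q' = 0"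
    using \<open>P = 0\<close> \<open>Q = 0\<close> by simp_all
  then have "p' = 0" "q' = 0" using N by simp_all
  with \<open>p = 0\<close> \<open>q = 0\<close> have eq: "A0 = A2" "A1 = A2" "B0 = B2" "B1 = B2" by (simp_all add: pq)
  \<comment> \<open>The differences vanish, so the three coefficients agree; their sum is zero,
    which is information from the quadratic factor.\<close>
  then have "3 * A2 = 0" "3 * B2 = 0" using A B by (simp_all add: algebra_simps)
  then have "A2 = 0" "B2 = 0" by (blast intro: zero)+
  with eq show ?thesis by simp
qed

text \<open>
  For \<open>c i j\<close> the coefficient of \<open>x\<^sup>i y\<^sup>j\<close>: the coefficients of \<open>y\<^sup>j\<close> and \<open>x y\<^sup>j\<close> are zero after
  imposing \<open>x\<^sup>2 = s\<close> and \<open>y\<^sup>3 = t\<close>.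
\<close>

definition block_vanishes :: "'f :: field \<Rightarrow> 'f \<Rightarrow> (nat \<Rightarrow> nat \<Rightarrow> 'f) \<Rightarrow> nat \<Rightarrow> bool" where
  "block_vanishes s t c j \<longleftrightarrow>
     (c 0 j + s * c 2 j) + t * (c 0 (j + 3) + s * c 2 (j + 3)) = 0 \<and>
     (c 1 j + s * c 3 j) + t * (c 1 (j + 3) + s * c 3 (j + 3)) = 0"

text \<open>\<open>\<kappa>\<close> sends \<open>x\<close> to a square root of \<open>s\<close> and
  \<open>y\<close> to the scalar \<open>t\<close>; \<open>\<mu>\<close> is the matrix representation
  with the same values of x^2 and y^3. The last conclusion says that together they determine the
  block.\<close>

lemma C6_C4_block:
  fixes G (structure) and s t :: "'f :: field"
  assumes "group G" and xy: "x \<in> carrier G" "y \<in> carrier G" "x [^] (4 :: nat) = \<one>" "y [^] (6 :: nat) = \<one>"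
    "y \<otimes> x \<otimes> y = x"
    and bij: "bij_betw (\<lambda>(i, j). x [^] i \<otimes> y [^] j) ({..<4 :: nat} \<times> {..<6 :: nat}) (carrier G)"
    and t: "t = 1 \<or> t = - 1" and s: "s = 1 \<or> s = - 1"
    and three: "(3 :: 'f) \<noteq> 0" and norm: "u ^ 2 - u * v + v ^ 2 = s"
  obtains \<kappa> \<mu> where "\<kappa> \<in> hom (group_algebra G) (quad_ring s)"
    "\<mu> \<in> hom (group_algebra G) (ring_mat TYPE('f) 2 ())"
    "\<And>a b j. \<kappa> a = \<kappa> b \<Longrightarrow> \<mu> a = \<mu> b \<Longrightarrow> j < 3 \<Longrightarrow>
      block_vanishes s t (\<lambda>i j. a (x [^] i \<otimes> y [^] j) - b (x [^] i \<otimes> y [^] j)) j"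
proof -
  interpret Q: cring "quad_ring s" by (rule cring_quad_ring)
  let ?M = "ring_mat TYPE('f) 2 ()"
  interpret M: ring ?M by (rule ring_mat)
  have tt: "t * t = 1" and ss: "s * s = 1" using t s by auto
  \<comment> \<open>\<open>Ym\<close> is \<open>t\<close> times a matrix of order 3, and \<open>Xm\<close> is the coordinate swap times \<open>u + v t Ym\<close>; the swap
    conjugates \<open>t Ym\<close> to its inverse, so \<open>Xm\<^sup>2\<close> is the scalar \<open>u\<^sup>2 - u v + v\<^sup>2\<close>.\<close>
  define Xm where "Xm = mat2 v (u - v) u (- v)"
  define Ym where "Ym = mat2 0 (- t) t (- t)"
  have [simp]: "Xm \<in> carrier_mat 2 2" "Ym \<in> carrier_mat 2 2" by (simp_all add: Xm_def Ym_def)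
  have qX: "(0, 1) [^]\<^bsub>quad_ring s\<^esub> (0 :: nat) = (1, 0)" "(0, 1) [^]\<^bsub>quad_ring s\<^esub> (1 :: nat) = (0, 1)"
    "(0, 1) [^]\<^bsub>quad_ring s\<^esub> (2 :: nat) = (s, 0)" "(0, 1) [^]\<^bsub>quad_ring s\<^esub> (3 :: nat) = (0, s)"
    "(0, 1) [^]\<^bsub>quad_ring s\<^esub> (4 :: nat) = (1, 0)"
    by (simp_all add: eval_nat_numeral quad_ring_simps ss)
  have qY: "(t, 0) [^]\<^bsub>quad_ring s\<^esub> j = (t ^ j, 0)" for j :: nat
    by (induction j) (simp_all add: quad_ring_simps)
  have t_pow: "t ^ 2 = 1" "t ^ 3 = t" "t ^ 4 = 1" "t ^ 5 = t" "t ^ 6 = 1"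
    using t by auto
  have XX: "Xm * Xm = mat2 s 0 0 s"
    unfolding Xm_def mat2_mult norm[symmetric] by (simp add: power2_eq_square algebra_simps)
  have mX: "Xm [^]\<^bsub>?M\<^esub> (0 :: nat) = mat2 1 0 0 1" "Xm [^]\<^bsub>?M\<^esub> (1 :: nat) = Xm"
    "Xm [^]\<^bsub>?M\<^esub> (2 :: nat) = mat2 s 0 0 s"
    "Xm [^]\<^bsub>?M\<^esub> (3 :: nat) = mat2 (s * v) (s * (u - v)) (s * u) (- (s * v))"
    "Xm [^]\<^bsub>?M\<^esub> (4 :: nat) = mat2 1 0 0 1"
  proof -
    show 0: "Xm [^]\<^bsub>?M\<^esub> (0 :: nat) = mat2 1 0 0 1" and 1: "Xm [^]\<^bsub>?M\<^esub> (1 :: nat) = Xm"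
      by (simp_all add: ring_mat_simps left_mult_one_mat[of Xm 2 2] flip: mat2_one)
    show 2: "Xm [^]\<^bsub>?M\<^esub> (2 :: nat) = mat2 s 0 0 s"
      using M.nat_pow_Suc[of Xm 1] 1 by (simp add: ring_mat_simps XX numeral_2_eq_2)
    then show 3: "Xm [^]\<^bsub>?M\<^esub> (3 :: nat) = mat2 (s * v) (s * (u - v)) (s * u) (- (s * v))"
      using M.nat_pow_Suc[of Xm 2] 2 by (simp add: ring_mat_simps Xm_def mat2_mult)
    have "Xm [^]\<^bsub>?M\<^esub> (2 + 2 :: nat) = mat2 1 0 0 1"
      unfolding M.nat_pow_mult[of Xm 2 2, symmetric, unfolded ring_mat_simps, OF \<open>Xm \<in> _\<close>] 2
      by (simp add: mat2_mult ss)
    then show "Xm [^]\<^bsub>?M\<^esub> (4 :: nat) = mat2 1 0 0 1" by simp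
  qed
  have mY: "Ym [^]\<^bsub>?M\<^esub> (0 :: nat) = mat2 1 0 0 1" "Ym [^]\<^bsub>?M\<^esub> (1 :: nat) = Ym"
    "Ym [^]\<^bsub>?M\<^esub> (2 :: nat) = mat2 (- 1) 1 (- 1) 0" "Ym [^]\<^bsub>?M\<^esub> (3 :: nat) = mat2 t 0 0 t"
    "Ym [^]\<^bsub>?M\<^esub> (4 :: nat) = mat2 0 (- 1) 1 (- 1)" "Ym [^]\<^bsub>?M\<^esub> (5 :: nat) = mat2 (- t) t (- t) 0"
    "Ym [^]\<^bsub>?M\<^esub> (6 :: nat) = mat2 1 0 0 1"
  proof -
    show 0: "Ym [^]\<^bsub>?M\<^esub> (0 :: nat) = mat2 1 0 0 1" and 1: "Ym [^]\<^bsub>?M\<^esub> (1 :: nat) = Ym"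
      by (simp_all add: ring_mat_simps left_mult_one_mat[of Ym 2 2] flip: mat2_one)
    show 2: "Ym [^]\<^bsub>?M\<^esub> (2 :: nat) = mat2 (- 1) 1 (- 1) 0"
      using M.nat_pow_Suc[of Ym 1] 1 by (simp add: ring_mat_simps numeral_2_eq_2) (simp add: Ym_def mat2_mult tt)
    show 3: "Ym [^]\<^bsub>?M\<^esub> (3 :: nat) = mat2 t 0 0 t"
      using M.nat_pow_Suc[of Ym 2] 2 by (simp add: ring_mat_simps Ym_def mat2_mult)
    show 4: "Ym [^]\<^bsub>?M\<^esub> (4 :: nat) = mat2 0 (- 1) 1 (- 1)"
      using M.nat_pow_Suc[of Ym 3] 3 by (simp add: ring_mat_simps Ym_def mat2_mult tt)
    show 5: "Ym [^]\<^bsub>?M\<^esub> (5 :: nat) = mat2 (- t) t (- t) 0"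
      using M.nat_pow_Suc[of Ym 4] 4 by (simp add: ring_mat_simps Ym_def mat2_mult)
    show "Ym [^]\<^bsub>?M\<^esub> (6 :: nat) = mat2 1 0 0 1"
      using M.nat_pow_Suc[of Ym 5] 5 by (simp add: ring_mat_simps Ym_def mat2_mult tt)
  qed
  obtain \<rho> where \<rho>: "\<rho> \<in> hom G (quad_ring s)"
    "\<And>(i :: nat) (j :: nat). \<rho> (x [^] i \<otimes> y [^] j) =
      (0, 1) [^]\<^bsub>quad_ring s\<^esub> i \<otimes>\<^bsub>quad_ring s\<^esub> (t, 0) [^]\<^bsub>quad_ring s\<^esub> j"
    by (rule C6_C4_hom_extend[OF assms(1) xy bij Q.monoid_axioms, of "(0, 1)" "(t, 0)"])
       (simp_all add: quad_ring_simps qX qY t_pow tt)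
  obtain \<sigma> where \<sigma>: "\<sigma> \<in> hom G ?M"
    "\<And>(i :: nat) (j :: nat). \<sigma> (x [^] i \<otimes> y [^] j) = Xm [^]\<^bsub>?M\<^esub> i \<otimes>\<^bsub>?M\<^esub> Ym [^]\<^bsub>?M\<^esub> j"
  proof (rule C6_C4_hom_extend[OF assms(1) xy bij M.monoid_axioms, of Xm Ym])
    show "Ym \<otimes>\<^bsub>?M\<^esub> Xm \<otimes>\<^bsub>?M\<^esub> Ym = Xm"
      using t by (auto simp: ring_mat_simps Xm_def Ym_def mat2_mult)
  qed (simp_all add: ring_mat_simps mX mY mat2_one)
  let ?\<kappa> = "\<lambda>a. (lin_ext G (fst \<circ> \<rho>) a, lin_ext G (snd \<circ> \<rho>) a)"
  let ?\<mu> = "\<lambda>a. mat 2 2 (\<lambda>ij. lin_ext G (\<lambda>g. \<sigma> g $$ ij) a)"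
  show thesis
  proof (rule that)
    show "?\<kappa> \<in> hom (group_algebra G) (quad_ring s)" by (rule lin_ext_quad_hom[OF assms(1) \<rho>(1)])
    show "?\<mu> \<in> hom (group_algebra G) ?M" by (rule lin_ext_mat_hom[OF assms(1) \<sigma>(1)])
  next
    fix a b and j :: nat
    assume eq: "?\<kappa> a = ?\<kappa> b" "?\<mu> a = ?\<mu> b" and j: "j < 3"
    define c where "c = (\<lambda>(i :: nat) (j :: nat). a (x [^] i \<otimes> y [^] j) - b (x [^] i \<otimes> y [^] j))"
    have lin: "(\<Sum>i<4. \<Sum>j<6. c i j * r (x [^] i \<otimes> y [^] j)) = 0" if "lin_ext G r a = lin_ext G r b" for r
      using that by (simp add: c_def lin_ext_C6_C4[OF bij] left_diff_distrib sum_subtractf)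
    have "lin_ext G (\<lambda>g. \<sigma> g $$ (k, l)) a = lin_ext G (\<lambda>g. \<sigma> g $$ (k, l)) b" if "k < 2" "l < 2" for k l
      using arg_cong[OF eq(2), of "\<lambda>m. m $$ (k, l)"] that by simp
    then have m: "(\<Sum>i<4. \<Sum>j<6. c i j * (Xm [^]\<^bsub>?M\<^esub> i * Ym [^]\<^bsub>?M\<^esub> j) $$ (k, l)) = 0" if "k < 2" "l < 2" for k l
      using that lin[of "\<lambda>g. \<sigma> g $$ (k, l)"] by (simp add: \<sigma>(2) ring_mat_simps)
    have q: "(\<Sum>i<4. \<Sum>j<6. c i j * fst ((0, 1) [^]\<^bsub>quad_ring s\<^esub> i \<otimes>\<^bsub>quad_ring s\<^esub> (t ^ j, 0))) = 0"
      "(\<Sum>i<4. \<Sum>j<6. c i j * snd ((0, 1) [^]\<^bsub>quad_ring s\<^esub> i \<otimes>\<^bsub>quad_ring s\<^esub> (t ^ j, 0))) = 0"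
      using eq(1) lin[of "fst \<circ> \<rho>"] lin[of "snd \<circ> \<rho>"] by (simp_all add: \<rho>(2) qY)
    define A where "A j = (c 0 j + s * c 2 j) + t * (c 0 (j + 3) + s * c 2 (j + 3))" for j
    define B where "B j = (c 1 j + s * c 3 j) + t * (c 1 (j + 3) + s * c 3 (j + 3))" for j
    have A_vals: "A 0 = (c 0 0 + s * c 2 0) + t * (c 0 3 + s * c 2 3)"
      "A 1 = (c 0 1 + s * c 2 1) + t * (c 0 4 + s * c 2 4)"
      "A 2 = (c 0 2 + s * c 2 2) + t * (c 0 5 + s * c 2 5)"
      and B_vals: "B 0 = (c 1 0 + s * c 3 0) + t * (c 1 3 + s * c 3 3)"
      "B 1 = (c 1 1 + s * c 3 1) + t * (c 1 4 + s * c 3 4)"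
      "B 2 = (c 1 2 + s * c 3 2) + t * (c 1 5 + s * c 3 5)"
      by (simp_all add: A_def B_def)
    \<comment> \<open>Write y = t w with w^3 = 1. The powers 1, y, y^2 are then 1, t w, w^2, so only
      the middle coefficient carries the sign \<open>t\<close>.\<close>
    have "A 0 = 0 \<and> t * A 1 = 0 \<and> A 2 = 0 \<and> B 0 = 0 \<and> t * B 1 = 0 \<and> B 2 = 0"
    proof (rule block_solve[OF _ three])
      show "u ^ 2 - u * v + v ^ 2 \<noteq> 0" using norm s by auto
      \<comment> \<open>In the quadratic representation w acts as 1, so its two coordinates give the
        coefficient sums.\<close>
      show "A 0 + t * A 1 + A 2 = 0" "B 0 + t * B 1 + B 2 = 0"
        using q unfolding sum_4_6 A_vals B_vals qX t_pow quad_ring_simps power_0 power_one_right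
        using t by (auto simp: algebra_simps)
      show "(A 0 - A 2) + (u * (t * B 1 - B 2) + v * (B 0 - B 2) - v * (t * B 1 - B 2)) = 0"
        using m[of 0 0] unfolding sum_4_6 A_vals B_vals mX mY unfolding Xm_def Ym_def mat2_mult
        using t by (auto simp: algebra_simps)
      show "- (t * A 1 - A 2) + (u * (B 0 - B 2) - v * (t * B 1 - B 2)) -
          (u * (t * B 1 - B 2) + v * (B 0 - B 2) - v * (t * B 1 - B 2)) = 0"
        using m[of 0 1] unfolding sum_4_6 A_vals B_vals mX mY unfolding Xm_def Ym_def mat2_mult
        using t by (auto simp: algebra_simps)
      show "(t * A 1 - A 2) + (u * (B 0 - B 2) - v * (t * B 1 - B 2)) = 0"
        using m[of 1 0] unfolding sum_4_6 A_vals B_vals mX mY unfolding Xm_def Ym_def mat2_mult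
        using t by (auto simp: algebra_simps)
      show "(A 0 - A 2) - (t * A 1 - A 2) - (u * (t * B 1 - B 2) + v * (B 0 - B 2) - v * (t * B 1 - B 2)) = 0"
        using m[of 1 1] unfolding sum_4_6 A_vals B_vals mX mY unfolding Xm_def Ym_def mat2_mult
        using t by (auto simp: algebra_simps)
    qed
    moreover have "t \<noteq> 0" using t by auto
    moreover from j have "j = 0 \<or> j = 1 \<or> j = 2" by auto
    ultimately have "A j = 0 \<and> B j = 0" by auto
    then have "block_vanishes s t c j" unfolding A_def B_def block_vanishes_def .
    then show "block_vanishes s t (\<lambda>i j. a (x [^] i \<otimes> y [^] j) - b (x [^] i \<otimes> y [^] j)) j"
      unfolding c_def .
  qed
qed

section \<open>The unit group\<close>

lemma card_carrier_mat:
  "card (carrier_mat m n :: 'f :: finite mat set) = CARD('f) ^ (m * n)"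
proof -
  let ?I = "{..<m} \<times> {..<n}"
  have "bij_betw (mat m n) (\<Pi>\<^sub>E ij\<in>?I. (UNIV :: 'f set)) (carrier_mat m n)"
    by (rule bij_betw_byWitness[where f' = "\<lambda>A. \<lambda>ij\<in>?I. A $$ ij"])
       (auto simp: PiE_iff extensional_def fun_eq_iff split: if_splits)
  then have "card (carrier_mat m n :: 'f mat set) = card (\<Pi>\<^sub>E ij\<in>?I. (UNIV :: 'f set))"
    by (simp add: bij_betw_same_card)
  then show ?thesis by (simp add: card_PiE)
qed

lemma card_group_algebra:
  assumes "finite (carrier G)"
  shows "card (carrier (group_algebra G :: ('g \<Rightarrow> 'f :: {field, finite}) ring)) = CARD('f) ^ card (carrier G)"
proof -
  have "bij_betw (\<lambda>a. restrict a (carrier G)) (carrier (group_algebra G :: ('g \<Rightarrow> 'f) ring))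
      (\<Pi>\<^sub>E g\<in>carrier G. (UNIV :: 'f set))"
    by (rule bij_betw_byWitness[where f' = "\<lambda>b g. if g \<in> carrier G then b g else 0"])
       (auto simp: group_algebra_def PiE_iff extensional_def fun_eq_iff)
  then have "card (carrier (group_algebra G :: ('g \<Rightarrow> 'f) ring)) = card (\<Pi>\<^sub>E g\<in>carrier G. (UNIV :: 'f set))"
    by (rule bij_betw_same_card)
  then show ?thesis using assms by (simp add: card_PiE)
qed

lemma card_group_power: "card (carrier (group_power G n)) = card (carrier G) ^ n"
  by (simp add: group_power_def card_PiE)

text \<open>Sums and differences over opposite signs isolate each term up to a factor 2. This
  recovers the coefficients of the group algebra from its four blocks.\<close>

lemma sign_solve:
  fixes a b c d :: "'f :: field"
  assumes two: "(2 :: 'f) \<noteq> 0"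
    and eq: "\<And>s t. s = 1 \<or> s = - 1 \<Longrightarrow> t = 1 \<or> t = - 1 \<Longrightarrow> (a + s * b) + t * (c + s * d) = 0"
  shows "a = 0 \<and> b = 0 \<and> c = 0 \<and> d = 0"
proof -
  have split: "x = 0 \<and> y = 0" if "x + y = 0" "x - y = 0" for x y :: 'f
  proof -
    have "2 * x = (x + y) + (x - y)" by simp
    then have "x = 0" using two that by simp
    then show ?thesis using that by simp
  qed
  note simps = mult_1 mult_minus1 diff_conv_add_uminus
  have "a + b = 0 \<and> c + d = 0"
    using eq[of 1 1] eq[of 1 "- 1"] by (intro split) (simp_all only: simps HOL.simp_thms)
  moreover have "a - b = 0 \<and> c - d = 0"
    using eq[of "- 1" 1] eq[of "- 1" "- 1"] by (intro split) (simp_all only: simps HOL.simp_thms)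
  ultimately show ?thesis using split by blast
qed

lemma units_group_algebra_C6_C4:
  fixes G :: "('g, 'm) monoid_scheme" (structure)
  assumes G: "is_C6_rtimes_C4 G" and two: "(2 :: 'f :: {field, finite}) \<noteq> 0" and three: "(3 :: 'f) \<noteq> 0"
  shows "units_of (group_algebra G :: ('g \<Rightarrow> 'f) ring) \<cong>
    group_power (units_of (quad_ring (1 :: 'f))) 2 \<times>\<times> group_power (units_of (quad_ring (- 1 :: 'f))) 2
      \<times>\<times> group_power (GL 2 TYPE('f)) 4"
proof -
  from G have group: "group G" and order: "card (carrier G) = 24"
    by (auto simp: is_C6_rtimes_C4_def has_presentation_def Coset.order_def)
  interpret group G by fact
  obtain x y where xy: "x \<in> carrier G" "y \<in> carrier G" "x [^] (4 :: nat) = \<one>" "y [^] (6 :: nat) = \<one>"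
    "y \<otimes> x \<otimes> y = x"
    and bij: "bij_betw (\<lambda>(i, j). x [^] i \<otimes> y [^] j) ({..<4 :: nat} \<times> {..<6 :: nat}) (carrier G)"
    by (rule C6_C4_normal_form[OF G])
  let ?A = "group_algebra G :: ('g \<Rightarrow> 'f) ring" and ?M = "ring_mat TYPE('f) 2 ()"
  let ?sgn = "\<lambda>s :: 'f. s = 1 \<or> s = - 1"
  let ?d = "\<lambda>(a :: 'g \<Rightarrow> 'f) b (i :: nat) (j :: nat). a (x [^] i \<otimes> y [^] j) - b (x [^] i \<otimes> y [^] j)"
  \<comment> \<open>Bundling the properties into one predicate lets \<open>\<kappa>\<close> and
    \<open>\<mu>\<close> be chosen as functions of the two signs.\<close>
  define P where "P s t \<kappa> \<mu> \<longleftrightarrow> \<kappa> \<in> hom ?A (quad_ring s) \<and> \<mu> \<in> hom ?A ?M \<and>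
    (\<forall>a b j. \<kappa> a = \<kappa> b \<longrightarrow> \<mu> a = \<mu> b \<longrightarrow> j < 3 \<longrightarrow> block_vanishes s t (?d a b) j)" for s t \<kappa> \<mu>
  have "\<exists>\<kappa> \<mu>. P s t \<kappa> \<mu>" if st: "?sgn s" "?sgn t" for s t
  proof -
    obtain u v where norm: "u ^ 2 - u * v + v ^ 2 = s" using ex_norm_form[OF three] by blast
    show ?thesis
      unfolding P_def by (rule C6_C4_block[OF group xy bij st(2,1) three norm]) blast
  qed
  then obtain \<kappa> \<mu> where P: "\<And>s t. ?sgn s \<Longrightarrow> ?sgn t \<Longrightarrow> P s t (\<kappa> s t) (\<mu> s t)"
    by metis
  \<comment> \<open>For n = 0, 1, 2, 3 the pair \<open>(sg n, tg n)\<close> runs through all four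
    sign pairs; for n < 2, \<open>tg n\<close> alone takes both values, indexing the two quadratic
    factors with a fixed \<open>s\<close>.\<close>
  define sg tg :: "nat \<Rightarrow> 'f" where "sg n = (if n < 2 then 1 else - 1)" and "tg n = (- 1) ^ n" for n
  have sgn: "?sgn (sg n)" "?sgn (tg n)" for n
    by (auto simp: sg_def tg_def minus_one_power_iff)
  let ?T = "group_power (quad_ring (1 :: 'f)) 2 \<times>\<times> group_power (quad_ring (- 1 :: 'f)) 2 \<times>\<times> group_power ?M 4"
  let ?F = "\<lambda>a. (\<lambda>n\<in>{..<2}. \<kappa> 1 (tg n) a, \<lambda>n\<in>{..<2}. \<kappa> (- 1) (tg n) a, \<lambda>n\<in>{..<4}. \<mu> (sg n) (tg n) a)"
  have closed: "\<kappa> s t a \<in> carrier (quad_ring s)" "\<mu> s t a \<in> carrier ?M"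
    if "?sgn s" "?sgn t" "a \<in> carrier ?A" for s t a
    using P[OF that(1,2), unfolded P_def] that(3) by (auto simp: hom_def)
  have mult: "\<kappa> s t (a \<otimes>\<^bsub>?A\<^esub> b) = \<kappa> s t a \<otimes>\<^bsub>quad_ring s\<^esub> \<kappa> s t b"
    "\<mu> s t (a \<otimes>\<^bsub>?A\<^esub> b) = \<mu> s t a \<otimes>\<^bsub>?M\<^esub> \<mu> s t b"
    if "?sgn s" "?sgn t" "a \<in> carrier ?A" "b \<in> carrier ?A" for s t a b
    using P[OF that(1,2), unfolded P_def] that(3,4) by (auto simp: hom_def)
  have hom: "?F \<in> hom ?A ?T"
  proof (rule homI)
    fix a assume "a \<in> carrier ?A"
    then show "?F a \<in> carrier ?T"
      using closed sgn by (simp add: group_power_def PiE_iff)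
  next
    fix a b assume "a \<in> carrier ?A" "b \<in> carrier ?A"
    then show "?F (a \<otimes>\<^bsub>?A\<^esub> b) = ?F a \<otimes>\<^bsub>?T\<^esub> ?F b"
      by (simp add: group_power_def mult sgn fun_eq_iff)
  qed
  have inj: "inj_on ?F (carrier ?A)"
  proof (rule inj_onI)
    fix a b assume ab: "a \<in> carrier ?A" "b \<in> carrier ?A" and eq: "?F a = ?F b"
    have "\<kappa> 1 (tg n) a = \<kappa> 1 (tg n) b" "\<kappa> (- 1) (tg n) a = \<kappa> (- 1) (tg n) b" if "n < 2" for n
      using eq that by (auto simp: fun_eq_iff restrict_def split: if_splits)
    from this[of 0] this[of 1] have k: "\<kappa> s t a = \<kappa> s t b" if "?sgn s" "?sgn t" for s t
      using that by (auto simp: tg_def)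
    have "\<mu> (sg n) (tg n) a = \<mu> (sg n) (tg n) b" if "n < 4" for n
      using eq that by (auto simp: fun_eq_iff restrict_def split: if_splits)
    from this[of 0] this[of 1] this[of 2] this[of 3] have m: "\<mu> s t a = \<mu> s t b" if "?sgn s" "?sgn t" for s t
      using that by (auto simp: tg_def sg_def)
    have c: "?d a b 0 j = 0 \<and> ?d a b 2 j = 0 \<and> ?d a b 0 (j + 3) = 0 \<and> ?d a b 2 (j + 3) = 0 \<and>
        ?d a b 1 j = 0 \<and> ?d a b 3 j = 0 \<and> ?d a b 1 (j + 3) = 0 \<and> ?d a b 3 (j + 3) = 0"
      if j: "j < 3" for j
    proof -
      define c where "c = ?d a b"
      have block: "block_vanishes s t c j" if st: "?sgn s" "?sgn t" for s t
        using P[OF st, unfolded P_def] k[OF st] m[OF st] j c_def by blast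
      have "c 0 j = 0 \<and> c 2 j = 0 \<and> c 0 (j + 3) = 0 \<and> c 2 (j + 3) = 0"
        by (rule sign_solve[OF two]) (use block in \<open>auto simp: block_vanishes_def\<close>)
      moreover have "c 1 j = 0 \<and> c 3 j = 0 \<and> c 1 (j + 3) = 0 \<and> c 3 (j + 3) = 0"
        by (rule sign_solve[OF two]) (use block in \<open>auto simp: block_vanishes_def\<close>)
      ultimately show ?thesis unfolding c_def by blast
    qed
    have "?d a b i j = 0" if "i < 4" "j < 6" for i j
    proof -
      have "i = 0 \<or> i = 1 \<or> i = 2 \<or> i = 3" using that(1) by auto
      \<comment> \<open>Exponents 3 to 5 of \<open>y\<close> are the partners \<open>l + 3\<close>
        of those below 3, already covered by \<open>c\<close>.\<close>
      moreover have "j < 3 \<or> (\<exists>l<3. j = l + 3)" using that(2) by presburger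
      ultimately show ?thesis using c by metis
    qed
    then have d: "a (x [^] i \<otimes> y [^] j) = b (x [^] i \<otimes> y [^] j)" if "i < 4" "j < 6" for i j :: nat
      using that by simp
    show "a = b"
    proof
      fix g
      show "a g = b g"
      proof (cases "g \<in> carrier G")
        case True
        then have "g \<in> (\<lambda>(i, j). x [^] i \<otimes> y [^] j) ` ({..<4 :: nat} \<times> {..<6 :: nat})"
          using bij by (simp add: bij_betw_def)
        then show ?thesis using d by auto
      next
        case False
        then show ?thesis using ab by (simp add: group_algebra_def)
      qed
    qed
  qed
  have fin: "finite (carrier G)" using order by (intro card_ge_0_finite) simp
  \<comment> \<open>Both sides have q^24 elements: the exponents on the product side add up as 2*2 +
    2*2 + 4*4 = 24.\<close>
  have card: "card (carrier ?T) = card (carrier ?A)"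
    by (simp add: card_group_algebra[OF fin] order card_cartesian_product card_group_power quad_ring_simps
        ring_mat_simps card_carrier_mat) (simp add: eval_nat_numeral mult.assoc)
  have "card (carrier ?T) > 0"
    unfolding card by (simp add: card_group_algebra[OF fin])
  then have "finite (carrier ?T)" by (rule card_ge_0_finite)
  moreover have "?F ` carrier ?A \<subseteq> carrier ?T" using hom by (auto simp: hom_def)
  ultimately have "?F ` carrier ?A = carrier ?T"
    using card_image[OF inj] card by (intro card_subset_eq) simp_all
  then have "?F \<in> iso ?A ?T" using hom inj by (simp add: iso_def bij_betw_def)
  moreover have "monoid ?T"
    by (intro DirProd_monoid monoid_group_power ring.is_monoid ring_mat cring.axioms(1) cring_quad_ring)
  moreover have "monoid ?A" using ring_group_algebra[OF group fin] ring.is_monoid by blast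
  ultimately have "units_of ?A \<cong> units_of ?T" by (intro units_of_iso)
  then show ?thesis by (simp add: units_of_DirProd units_of_group_power GL_def)
qed

theorem theorem2p8:
  fixes G :: "('g, 'm) monoid_scheme" and p k q :: nat
  assumes "CHAR('f :: {field, finite}) = p"
    and "CARD('f) = q" and "q = p ^ k"
    and "is_C6_rtimes_C4 G"
    and "p > 3"
  shows
    "([q = 1] (mod 12) \<or> [q = 5] (mod 12) \<longrightarrow>
        units_of (group_algebra G :: ('g \<Rightarrow> 'f) ring) \<cong>
          group_power (cyclic (p ^ k - 1)) 8 \<times>\<times> group_power (GL 2 TYPE('f)) 4) \<and>
     ([int q = - 1] (mod 12) \<or> [int q = - 5] (mod 12) \<longrightarrow>
        units_of (group_algebra G :: ('g \<Rightarrow> 'f) ring) \<cong>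
          group_power (cyclic (p ^ k - 1)) 4 \<times>\<times> group_power (cyclic (p ^ (2 * k) - 1)) 2
            \<times>\<times> group_power (GL 2 TYPE('f)) 4)"
proof -
  let ?U = "units_of (group_algebra G :: ('g \<Rightarrow> 'f) ring)"
  let ?C = "cyclic (q - 1)" and ?GL = "group_power (GL 2 TYPE('f)) 4"
  let ?U1 = "units_of (quad_ring (1 :: 'f))" and ?U2 = "units_of (quad_ring (- 1 :: 'f))"
  have nonzero: "(of_nat n :: 'f) \<noteq> 0" if "0 < n" "n < p" for n
    using that assms(1) by (auto simp: of_nat_eq_0_iff_char_dvd dest: dvd_imp_le)
  have two: "(2 :: 'f) \<noteq> 0" and three: "(3 :: 'f) \<noteq> 0"
    using nonzero[of 2] nonzero[of 3] assms(5) by simp_all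
  note iso = units_group_algebra_C6_C4[OF assms(4) two three]
  have gU: "group (units_of (quad_ring s))" for s :: 'f
    using cring.axioms(1)[OF cring_quad_ring] ring.is_monoid monoid.units_group by blast
  have gGL: "group ?GL"
    unfolding GL_def by (intro group_group_power monoid.units_group ring.is_monoid ring_mat)
  \<comment> \<open>1 is its own square root, so the quadratic ring for \<open>s = 1\<close> splits
    in both cases.\<close>
  have U1: "?U1 \<cong> ?C \<times>\<times> ?C"
    using units_quad_ring_split[of "1 :: 'f"] two assms(2) by simp
  then have U1': "group_power ?U1 2 \<cong> group_power ?C 4"
    using group_power_square[of ?U1 ?C 2] by simp
  show ?thesis
  proof (intro conjI impI)
    assume "[q = 1] (mod 12) \<or> [q = 5] (mod 12)"
    then have "q mod 12 = 1 \<or> q mod 12 = 5" by (simp add: cong_def)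
    \<comment> \<open>Both residues are 1 modulo 4, so -1 is a square and the blocks with
      \<open>s = - 1\<close> split as well.\<close>
    then have q: "q mod 4 = 1" "odd q" by presburger+
    then obtain r :: 'f where r: "r ^ 2 = - 1"
      using minus_one_square_iff[where 'f = 'f] two assms(2) by blast
    then have "r \<noteq> 0" by auto
    have "?U2 \<cong> ?C \<times>\<times> ?C"
      using units_quad_ring_split[OF \<open>r \<noteq> 0\<close> two] r assms(2) by simp
    then have U2': "group_power ?U2 2 \<cong> group_power ?C 4"
      using group_power_square[of ?U2 ?C 2] by simp
    have "group_power ?U1 2 \<times>\<times> group_power ?U2 2 \<times>\<times> ?GL \<cong> group_power ?C 4 \<times>\<times> group_power ?C 4 \<times>\<times> ?GL"
      by (intro group.DirProd_iso_trans group_group_power gU U1' U2' iso_refl)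
    also have "\<dots> \<cong> (group_power ?C 4 \<times>\<times> group_power ?C 4) \<times>\<times> ?GL" by (rule DirProd_assoc_iso)
    also have "\<dots> \<cong> group_power ?C 8 \<times>\<times> ?GL"
      using group_power_add[of ?C 4 4]
      by (intro group.DirProd_iso_trans DirProd_group group_group_power iso_refl) simp_all
    finally show "?U \<cong> group_power (cyclic (p ^ k - 1)) 8 \<times>\<times> ?GL"
      using iso iso_trans unfolding assms(3) by blast
  next
    assume "[int q = - 1] (mod 12) \<or> [int q = - 5] (mod 12)"
    \<comment> \<open>The integer residues -1 and -5 become 11 and 7, both 3 modulo 4; hence -1 is
      not a square and each of the two quadratic rings with \<open>s = - 1\<close> is a field with
      q^2 elements.\<close>
    then have "q mod 12 = 11 \<or> q mod 12 = 7"
      using zmod_int[of q 12] by (auto simp: cong_def)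
    then have q: "q mod 4 \<noteq> 1" "odd q" by presburger+
    then have "\<And>r :: 'f. r ^ 2 \<noteq> - 1"
      using minus_one_square_iff[where 'f = 'f] two assms(2) by blast
    then have "?U2 \<cong> cyclic (CARD('f) ^ 2 - 1)" by (rule units_quad_ring_field)
    moreover have "CARD('f) ^ 2 = p ^ (2 * k)" by (simp add: assms(2,3) power_mult mult.commute)
    ultimately have U2: "?U2 \<cong> cyclic (p ^ (2 * k) - 1)" by simp
    have "group_power ?U1 2 \<times>\<times> group_power ?U2 2 \<times>\<times> ?GL \<cong>
        group_power ?C 4 \<times>\<times> group_power (cyclic (p ^ (2 * k) - 1)) 2 \<times>\<times> ?GL"
      by (intro group.DirProd_iso_trans group_group_power gU U1' group_power_iso U2 iso_refl)
    then show "?U \<cong> group_power (cyclic (p ^ k - 1)) 4 \<times>\<times> group_power (cyclic (p ^ (2 * k) - 1)) 2 \<times>\<times> ?GL"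
      using iso iso_trans unfolding assms(3) by blast
  qed
qed

end
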